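(* The complete twisted sum $do(\ell_2)$ induced by the couple $(\min(\ell_2),\max(\ell_2))$ at $\theta=\frac12$, with the multiplication $$(x_1,y_1)(x_2,y_2)=(x_1x_2,\;x_1y_2+y_1x_2)$$ (where products in $\ell_2$ are coordinatewise), is not an operator algebra.
   Context: For a Banach space $X$: $\|x\|_{M_n(\min(X))}=\sup\{\|(f(x_{ij}))\|_{M_n}:f\in X^*,\|f\|\le1\}$ and $\|x\|_{M_n(\max(X))}=\inf\{\|A\|\|D\|\|B\|\}$ over factorizations $x=ADB$ with $A,B$ scalar matrices and $D$ diagonal with entries in $X$. For a compatible couple $(X_0,X_1)$ of operator spaces, $\Sigma=X_0+X_1$ with norm $\inf\{\|x_0\|_{X_0}+\|x_1\|_{X_1}:x=x_0+x_1\}$, $\mathbb S=\{0\le\mathrm{Re}\,z\le1\}$. $\mathcal F(X_0,X_1)$ is the Banach space of functions $f:\mathbb S\to\Sigma$ bounded and continuous on $\mathbb S$, analytic in its interior, with $f(it)\in X_0$, $f(1+it)\in X_1$ and $t\mapsto\|f(it)\|_{X_0}$, $t\mapsto\|f(1+it)\|_{X_1}$ bounded and continuous, with norm $\max\{\sup_t\|f(it)\|_{X_0},\sup_t\|f(1+it)\|_{X_1}\}$ and operator space structure $M_n(\mathcal F(X_0,X_1))=\mathcal F(M_n(X_0),M_n(X_1))$. With $\delta_\theta(f)=f(\theta)$, $\delta_\theta'(f)=f'(\theta)$, $dX_\theta=\mathcal F/(\ker\delta_\theta\cap\ker\delta_\theta')=\{(f(\theta),f'(\theta)):f\in\mathcal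 F\}$ with the quotient operator space structure ($M_n(X/Y)=M_n(X)/M_n(Y)$). $do(\ell_2)$ is the space $dX_{1/2}$ for $X_0=\min(\ell_2)$, $X_1=\max(\ell_2)$ (compatible via the identity of $\ell_2$); as a vector space it is $\ell_2\times\ell_2$. An operator algebra is an operator space $A$ that is also a Banach algebra and such that the inclusion $A\subset B(H)$ giving its operator space structure can be taken to respect the algebraic operations. The paper uses the known characterization: a Banach algebra with an operator space structure is an operator algebra if and only if the maps $m_n:M_n(A)\times M_n(A)\to M_n(A)$, $m_n((x_{ij}),(y_{ij}))=(\sum_k x_{ik}y_{kj})_{ij}$, are uniformly bounded in $n$ (multiplication completely bounded in the Haagerup sense); that is, the representation is understood up to complete isomorphism. *)

theory Defs
  imports "HOL-Analysis.Analysis" "HOL-Library.Function_Algebras"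
begin

class complex_vec = ab_group_add +
  fixes scaleC :: "complex \<Rightarrow> 'a \<Rightarrow> 'a"  (infixr "*\<^sub>C" 75)
  assumes scaleC_add_right: "c *\<^sub>C (x + y) = c *\<^sub>C x + c *\<^sub>C y"
    and scaleC_add_left: "(c + d) *\<^sub>C x = c *\<^sub>C x + d *\<^sub>C x"
    and scaleC_scaleC: "c *\<^sub>C d *\<^sub>C x = (c * d) *\<^sub>C x"
    and scaleC_one: "1 *\<^sub>C x = x"

instantiation complex :: complex_vec
begin
definition scaleC_complex_def: "c *\<^sub>C (x::complex) = c * x"
instance by standard (auto simp: scaleC_complex_def algebra_simps)
end

instantiation "fun" :: (type, complex_vec) complex_vec
begin
definition scaleC_fun_def: "c *\<^sub>C f = (\<lambda>i. c *\<^sub>C f i)"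
instance by standard
  (auto simp: scaleC_fun_def fun_eq_iff scaleC_add_right scaleC_add_left scaleC_scaleC scaleC_one)
end

instantiation prod :: (complex_vec, complex_vec) complex_vec
begin
definition scaleC_prod_def: "c *\<^sub>C p = (c *\<^sub>C fst p, c *\<^sub>C snd p)"
instance by standard
  (auto simp: scaleC_prod_def scaleC_add_right scaleC_add_left scaleC_scaleC scaleC_one prod_eq_iff)
end

text \<open>Complex Hilbert spaces. The inner product is linear in the second variable; the real inner
  product and the norm of the underlying real Hilbert space are the ones it induces.\<close>

class complex_hilbert = complex_vec + real_inner + complete_space +
  fixes cinner :: "'a \<Rightarrow> 'a \<Rightarrow> complex"
  assumes scaleR_scaleC: "r *\<^sub>R x = complex_of_real r *\<^sub>C x"
    and cinner_commute: "cinner x y = cnj (cinner y x)"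
    and cinner_add_right: "cinner x (y + z) = cinner x y + cinner x z"
    and cinner_scaleC_right: "cinner x (c *\<^sub>C y) = c * cinner x y"
    and inner_cinner: "inner x y = Re (cinner x y)"

text \<open>Normed spaces and operator spaces are given by a carrier in an ambient complex vector space.
  An \<open>n \<times> n\<close> matrix is a function of two indices, of which only the values at
  \<open>i, j < n\<close> matter; \<open>mnorm E n\<close> is the norm of \<open>M\<^sub>n(E)\<close>.\<close>

record 'v nspace =
  vset :: "'v set"
  vnorm :: "'v \<Rightarrow> real"

record 'v opspace =
  oset :: "'v set"
  mnorm :: "nat \<Rightarrow> (nat \<Rightarrow> nat \<Rightarrow> 'v) \<Rightarrow> real"

text \<open>Matrices are extended by zero, so that they form a linear subspace of the functions of two
  indices.\<close>

definition Mat :: "nat \<Rightarrow> 'v::zero opspace \<Rightarrow> (nat \<Rightarrow> nat \<Rightarrow> 'v) nspace" where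
  "Mat n E = \<lparr> vset = {x. (\<forall>i<n. \<forall>j<n. x i j \<in> oset E) \<and> (\<forall>i j. \<not> (i < n \<and> j < n) \<longrightarrow> x i j = 0)},
               vnorm = mnorm E n \<rparr>"

definition base :: "'v::zero opspace \<Rightarrow> 'v nspace" where
  "base E = \<lparr> vset = oset E, vnorm = (\<lambda>x. mnorm E 1 (\<lambda>i j. if i = 0 \<and> j = 0 then x else 0)) \<rparr>"

text \<open>Norm of a matrix of operators, as an operator between Hilbertian direct sums.\<close>

definition op_matrix_norm ::
    "nat \<Rightarrow> nat \<Rightarrow> (nat \<Rightarrow> nat \<Rightarrow> 'a::real_normed_vector \<Rightarrow> 'b::real_normed_vector) \<Rightarrow> real" where
  "op_matrix_norm m n T =
     Sup {sqrt (\<Sum>i<m. (norm (\<Sum>j<n. T i j (\<xi> j)))\<^sup>2) | \<xi>. (\<Sum>j<n. (norm (\<xi> j))\<^sup>2) \<le> 1}"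

definition scalar_matrix_norm :: "nat \<Rightarrow> nat \<Rightarrow> (nat \<Rightarrow> nat \<Rightarrow> complex) \<Rightarrow> real" where
  "scalar_matrix_norm m n a = op_matrix_norm m n (\<lambda>i j t. a i j * t)"

definition dual_ball :: "'v::complex_vec nspace \<Rightarrow> ('v \<Rightarrow> complex) set" where
  "dual_ball X = {f. (\<forall>x\<in>vset X. \<forall>y\<in>vset X. f (x + y) = f x + f y) \<and>
                     (\<forall>c. \<forall>x\<in>vset X. f (c *\<^sub>C x) = c * f x) \<and>
                     (\<forall>x\<in>vset X. cmod (f x) \<le> vnorm X x)}"

definition min_os :: "'v::complex_vec nspace \<Rightarrow> 'v opspace" where
  "min_os X = \<lparr> oset = vset X,
     mnorm = (\<lambda>n x. Sup {scalar_matrix_norm n n (\<lambda>i j. f (x i j)) | f. f \<in> dual_ball X}) \<rparr>"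

text \<open>In a factorization \<open>x = A D B\<close> the diagonal matrix \<open>D\<close> may have any size
  \<open>N\<close>, and its norm is the maximum of the norms of its entries \<open>d 0, \<dots>, d (N - 1)\<close>.\<close>

definition max_os :: "'v::complex_vec nspace \<Rightarrow> 'v opspace" where
  "max_os X = \<lparr> oset = vset X,
     mnorm = (\<lambda>n x. Inf {scalar_matrix_norm n N A * Max (insert 0 ((\<lambda>k. vnorm X (d k)) ` {..<N}))
                            * scalar_matrix_norm N n B | N A d B.
                (\<forall>k<N. d k \<in> vset X) \<and>
                (\<forall>i<n. \<forall>j<n. x i j = (\<Sum>k<N. (A i k * B k j) *\<^sub>C d k))}) \<rparr>"

definition sum_nspace :: "'v::complex_vec nspace \<Rightarrow> 'v nspace \<Rightarrow> 'v nspace" where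
  "sum_nspace X Y = \<lparr> vset = {x + y | x y. x \<in> vset X \<and> y \<in> vset Y},
     vnorm = (\<lambda>z. Inf {vnorm X x + vnorm Y y | x y. x \<in> vset X \<and> y \<in> vset Y \<and> z = x + y}) \<rparr>"

definition has_cderiv ::
    "'v::complex_vec nspace \<Rightarrow> (complex \<Rightarrow> 'v) \<Rightarrow> 'v \<Rightarrow> complex \<Rightarrow> bool" where
  "has_cderiv X f d z \<longleftrightarrow> d \<in> vset X \<and>
     ((\<lambda>w. vnorm X (inverse (w - z) *\<^sub>C (f w - f z) - d)) \<longlongrightarrow> 0) (at z)"

definition cderiv :: "'v::complex_vec nspace \<Rightarrow> (complex \<Rightarrow> 'v) \<Rightarrow> complex \<Rightarrow> 'v" where
  "cderiv X f z = (THE d. has_cderiv X f d z)"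

definition strip :: "complex set" where
  "strip = {z. 0 \<le> Re z \<and> Re z \<le> 1}"

text \<open>Functions on the strip are extended by zero.\<close>

definition calderon :: "'v::complex_vec nspace \<Rightarrow> 'v nspace \<Rightarrow> (complex \<Rightarrow> 'v) nspace" where
  "calderon X0 X1 = (let S = sum_nspace X0 X1 in
     \<lparr> vset = {f. (\<forall>z. z \<notin> strip \<longrightarrow> f z = 0) \<and>
                 (\<forall>z\<in>strip. f z \<in> vset S) \<and>
                 bdd_above ((\<lambda>z. vnorm S (f z)) ` strip) \<and>
                 (\<forall>z\<in>strip. ((\<lambda>w. vnorm S (f w - f z)) \<longlongrightarrow> 0) (at z within strip)) \<and>
                 (\<forall>z\<in>interior strip. \<exists>d. has_cderiv S f d z) \<and>
                 (\<forall>t::real. f (\<i> * t) \<in> vset X0 \<and> f (1 + \<i> * t) \<in> vset X1) \<and>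
                 bdd_above (range (\<lambda>t::real. vnorm X0 (f (\<i> * t)))) \<and>
                 bdd_above (range (\<lambda>t::real. vnorm X1 (f (1 + \<i> * t)))) \<and>
                 continuous_on UNIV (\<lambda>t::real. vnorm X0 (f (\<i> * t))) \<and>
                 continuous_on UNIV (\<lambda>t::real. vnorm X1 (f (1 + \<i> * t)))},
       vnorm = (\<lambda>f. max (SUP t::real. vnorm X0 (f (\<i> * t))) (SUP t::real. vnorm X1 (f (1 + \<i> * t)))) \<rparr>)"

text \<open>The operator space structure is \<open>M\<^sub>n(\<F>(E0, E1)) = \<F>(M\<^sub>n(E0), M\<^sub>n(E1))\<close>.\<close>

definition calderon_os ::
    "'v::complex_vec opspace \<Rightarrow> 'v opspace \<Rightarrow> (complex \<Rightarrow> 'v) opspace" where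
  "calderon_os E0 E1 = \<lparr> oset = vset (calderon (base E0) (base E1)),
     mnorm = (\<lambda>n \<phi>. vnorm (calderon (Mat n E0) (Mat n E1)) (\<lambda>z i j. \<phi> i j z)) \<rparr>"

text \<open>The quotient of \<open>E\<close> by the kernel of a linear map \<open>q\<close>, identified with the
  range of \<open>q\<close>: the norm of \<open>M\<^sub>n(E) / M\<^sub>n(ker q)\<close> is the infimum over all
  liftings.\<close>

definition quotient_os :: "('v::zero \<Rightarrow> 'w) \<Rightarrow> 'v opspace \<Rightarrow> 'w opspace" where
  "quotient_os q E = \<lparr> oset = q ` oset E,
     mnorm = (\<lambda>n x. Inf {mnorm E n \<phi> | \<phi>. \<phi> \<in> vset (Mat n E) \<and>
                                           (\<forall>i<n. \<forall>j<n. q (\<phi> i j) = x i j)}) \<rparr>"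

definition dX :: "complex \<Rightarrow> 'v::complex_vec opspace \<Rightarrow> 'v opspace \<Rightarrow> ('v \<times> 'v) opspace" where
  "dX \<theta> E0 E1 =
     quotient_os (\<lambda>f. (f \<theta>, cderiv (sum_nspace (base E0) (base E1)) f \<theta>)) (calderon_os E0 E1)"

definition ell2 :: "(nat \<Rightarrow> complex) nspace" where
  "ell2 = \<lparr> vset = {x. summable (\<lambda>k. (cmod (x k))\<^sup>2)},
            vnorm = (\<lambda>x. sqrt (\<Sum>k. (cmod (x k))\<^sup>2)) \<rparr>"

definition do_ell2 :: "((nat \<Rightarrow> complex) \<times> (nat \<Rightarrow> complex)) opspace" where
  "do_ell2 = dX (1/2) (min_os ell2) (max_os ell2)"

fun do_mult :: "(nat \<Rightarrow> complex) \<times> (nat \<Rightarrow> complex) \<Rightarrow> (nat \<Rightarrow> complex) \<times> (nat \<Rightarrow> complex)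
    \<Rightarrow> (nat \<Rightarrow> complex) \<times> (nat \<Rightarrow> complex)" where
  "do_mult (x1, y1) (x2, y2) = (\<lambda>k. x1 k * x2 k, \<lambda>k. x1 k * y2 k + y1 k * x2 k)"

definition bounded_ops :: "('h::complex_hilbert \<Rightarrow> 'h) set" where
  "bounded_ops = {T. bounded_linear T \<and> (\<forall>c \<xi>. T (c *\<^sub>C \<xi>) = c *\<^sub>C T \<xi>)}"

text \<open>A map that is multiplicative and a complete isomorphism onto its range in \<open>B(H)\<close>.\<close>

definition algebra_representation ::
    "'v::complex_vec opspace \<Rightarrow> ('v \<Rightarrow> 'v \<Rightarrow> 'v) \<Rightarrow> ('v \<Rightarrow> 'h::complex_hilbert \<Rightarrow> 'h) \<Rightarrow> bool" where
  "algebra_representation A m \<pi> \<longleftrightarrow>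
     (\<forall>x\<in>oset A. \<pi> x \<in> bounded_ops) \<and>
     (\<forall>x\<in>oset A. \<forall>y\<in>oset A. \<pi> (x + y) = (\<lambda>\<xi>. \<pi> x \<xi> + \<pi> y \<xi>)) \<and>
     (\<forall>c. \<forall>x\<in>oset A. \<pi> (c *\<^sub>C x) = (\<lambda>\<xi>. c *\<^sub>C \<pi> x \<xi>)) \<and>
     (\<forall>x\<in>oset A. \<forall>y\<in>oset A. \<pi> (m x y) = \<pi> x \<circ> \<pi> y) \<and>
     (\<exists>c>0. \<exists>C. \<forall>n. \<forall>x \<in> vset (Mat n A).
        c * mnorm A n x \<le> op_matrix_norm n n (\<lambda>i j. \<pi> (x i j)) \<and>
        op_matrix_norm n n (\<lambda>i j. \<pi> (x i j)) \<le> C * mnorm A n x)"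

text \<open>An operator space \<open>A\<close> with a product \<open>m\<close> is an operator algebra, up to
  complete isomorphism, when it is represented on some Hilbert space. The type of the Hilbert space
  is a parameter: not being an operator algebra means that the predicate fails for every type
  \<open>'h\<close>. Bilinearity, associativity and boundedness of \<open>m\<close> are inherited from
  \<open>B(H)\<close> through the representation.\<close>

definition operator_algebra ::
    "'h::complex_hilbert itself \<Rightarrow> 'v::complex_vec opspace \<Rightarrow> ('v \<Rightarrow> 'v \<Rightarrow> 'v) \<Rightarrow> bool" where
  "operator_algebra H A m \<longleftrightarrow>
     (\<forall>x\<in>oset A. \<forall>y\<in>oset A. m x y \<in> oset A) \<and>
     (\<exists>\<pi> :: 'v \<Rightarrow> 'h \<Rightarrow> 'h. algebra_representation A m \<pi>)"

end

theory Submission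
  imports Defs "HOL-Complex_Analysis.Conformal_Mappings"
begin

text \<open>
  Place \<open>n\<close> basis vectors \<open>e\<^sub>k\<close> in a row, or in a column, of an \<open>n \<times> n\<close>
  matrix. The result has norm at most \<open>1\<close> over \<open>min(\<ell>\<^sub>2)\<close> (Bessel's inequality) and at most
  \<open>\<surd>n\<close> over \<open>max(\<ell>\<^sub>2)\<close> (an explicit factorization). The scalar function
  \<open>n powr (- (z - 1/2) / 2)\<close> balances the two sides of the strip: multiplied by this row it is a
  function of norm at most \<open>n powr (1/4)\<close> whose value at \<open>1/2\<close> is the row and whose derivative is
  \<open>- (ln n) / 2\<close> times the row. Hence with \<open>a\<^sub>k = (e\<^sub>k, - (ln n) / 2 e\<^sub>k)\<close> both the row and
  the column of the \<open>a\<^sub>k\<close> have norm at most \<open>n powr (1/4)\<close> over \<open>do(\<ell>\<^sub>2)\<close>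
  (lemma \<open>do_norm_line\<close>).

  The product of the row and the column has one nonzero entry,
  \<open>\<Sum>\<^sub>k a\<^sub>k a\<^sub>k = (s, - (ln n) s)\<close> with \<open>s = e\<^sub>0 + \<dots> + e\<^sub>n\<^sub>-\<^sub>1\<close>. In a single
  entry there is nothing left to balance, because \<open>min\<close> and \<open>max\<close> both restrict to the norm of
  \<open>\<ell>\<^sub>2\<close>: the functional \<open>x \<mapsto> \<langle>s, x\<rangle> / \<surd>n\<close> turns a lifting of norm
  \<open>M\<close> into a scalar function that is bounded by \<open>M\<close> on both sides of the strip, hence inside it by
  the three lines theorem, and Cauchy's estimate on the disc of radius \<open>1/2\<close> bounds its derivative
  \<open>- (ln n) \<surd>n\<close> by \<open>2 M\<close> (lemmas \<open>strip_derivative_bound\<close>, \<open>calderon_norm_lower\<close>).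

  In \<open>B(H)\<close> the norm of a product of a row and a column is at most the product of their norms. A
  representation with constants \<open>c\<close> and \<open>C\<close> would therefore give
  \<open>c (ln n) \<surd>n / 2 \<le> (C n powr (1/4))\<^sup>2\<close>, that is \<open>c (ln n) / 2 \<le> C\<^sup>2\<close>, for every \<open>n \<ge> 1\<close>.
\<close>

section \<open>Norms of operator and scalar matrices\<close>

lemma op_matrix_norm_least:
  assumes "\<And>\<xi>. (\<Sum>j<n. (norm (\<xi> j))\<^sup>2) \<le> 1 \<Longrightarrow> sqrt (\<Sum>i<m. (norm (\<Sum>j<n. T i j (\<xi> j)))\<^sup>2) \<le> B"
  shows "op_matrix_norm m n T \<le> B"
  unfolding op_matrix_norm_def
proof (rule cSup_least)
  show "{sqrt (\<Sum>i<m. (norm (\<Sum>j<n. T i j (\<xi> j)))\<^sup>2) | \<xi>. (\<Sum>j<n. (norm (\<xi> j))\<^sup>2) \<le> 1} \<noteq> {}"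
    by (auto intro!: exI[of _ "\<lambda>_. 0"])
qed (use assms in auto)

text \<open>A matrix of bounded operators is bounded by the sum of the operator norms of its entries, so
  the supremum that defines its norm is over a bounded set.\<close>

lemma op_matrix_norm_upper:
  assumes T: "\<And>i j. i < m \<Longrightarrow> j < n \<Longrightarrow> bounded_linear (T i j)"
    and "(\<Sum>j<n. (norm (\<xi> j))\<^sup>2) \<le> 1"
  shows "sqrt (\<Sum>i<m. (norm (\<Sum>j<n. T i j (\<xi> j)))\<^sup>2) \<le> op_matrix_norm m n T"
  unfolding op_matrix_norm_def
proof (rule cSup_upper)
  have "sqrt (\<Sum>i<m. (norm (\<Sum>j<n. T i j (\<eta> j)))\<^sup>2) \<le> (\<Sum>i<m. \<Sum>j<n. onorm (T i j))"
    if \<eta>: "(\<Sum>j<n. (norm (\<eta> j))\<^sup>2) \<le> 1" for \<eta>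
  proof -
    have 1: "norm (\<eta> j) \<le> 1" if "j < n" for j
    proof -
      have "(norm (\<eta> j))\<^sup>2 \<le> (\<Sum>j<n. (norm (\<eta> j))\<^sup>2)"
        using that by (intro member_le_sum) auto
      then show ?thesis using \<eta> abs_square_le_1[of "norm (\<eta> j)"] by simp
    qed
    have "norm (\<Sum>j<n. T i j (\<eta> j)) \<le> (\<Sum>j<n. onorm (T i j))" if "i < m" for i
    proof (rule order_trans[OF norm_sum sum_mono])
      fix j assume "j \<in> {..<n}"
      then have b: "bounded_linear (T i j)" and n: "norm (\<eta> j) \<le> 1" using T that 1 by auto
      have "norm (T i j (\<eta> j)) \<le> onorm (T i j) * norm (\<eta> j)" by (rule onorm[OF b])
      also have "\<dots> \<le> onorm (T i j)" using n onorm_pos_le[OF b] by (simp add: mult_left_le)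
      finally show "norm (T i j (\<eta> j)) \<le> onorm (T i j)" .
    qed
    then have "(\<Sum>i<m. norm (\<Sum>j<n. T i j (\<eta> j))) \<le> (\<Sum>i<m. \<Sum>j<n. onorm (T i j))"
      by (intro sum_mono) auto
    moreover have "sqrt (\<Sum>i<m. (norm (\<Sum>j<n. T i j (\<eta> j)))\<^sup>2) \<le> (\<Sum>i<m. norm (\<Sum>j<n. T i j (\<eta> j)))"
      using L2_set_le_sum[of "{..<m}" "\<lambda>i. norm (\<Sum>j<n. T i j (\<eta> j))"] by (simp add: L2_set_def)
    ultimately show ?thesis by linarith
  qed
  then show "bdd_above {sqrt (\<Sum>i<m. (norm (\<Sum>j<n. T i j (\<xi> j)))\<^sup>2) | \<xi>. (\<Sum>j<n. (norm (\<xi> j))\<^sup>2) \<le> 1}"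
    by (auto intro!: bdd_aboveI)
qed (use assms in auto)

lemma op_matrix_norm_nonneg:
  assumes "\<And>i j. i < m \<Longrightarrow> j < n \<Longrightarrow> bounded_linear (T i j)"
  shows "0 \<le> op_matrix_norm m n T"
proof -
  have "0 \<le> sqrt (\<Sum>i<m. (norm (\<Sum>j<n. T i j 0))\<^sup>2)" by (intro real_sqrt_ge_zero sum_nonneg) auto
  also have "\<dots> \<le> op_matrix_norm m n T"
    using op_matrix_norm_upper[OF assms, where \<xi> = "\<lambda>_. 0"] by simp
  finally show ?thesis .
qed

lemma op_matrix_norm_apply:
  assumes T: "\<And>i j. i < m \<Longrightarrow> j < n \<Longrightarrow> bounded_linear (T i j)"
  shows "L2_set (\<lambda>i. norm (\<Sum>j<n. T i j (\<xi> j))) {..<m}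
         \<le> op_matrix_norm m n T * L2_set (\<lambda>j. norm (\<xi> j)) {..<n}"
proof -
  define s where "s = L2_set (\<lambda>j. norm (\<xi> j)) {..<n}"
  have s0: "s \<ge> 0" by (simp add: s_def L2_set_nonneg)
  show ?thesis
  proof (cases "s = 0")
    case True
    then have "\<xi> j = 0" if "j < n" for j
      using that by (simp add: s_def L2_set_eq_0_iff)
    then have "(\<Sum>j<n. T i j (\<xi> j)) = 0" if "i < m" for i
      using that T by (intro sum.neutral) (auto simp: linear_0 bounded_linear.linear)
    then have "L2_set (\<lambda>i. norm (\<Sum>j<n. T i j (\<xi> j))) {..<m} = 0"
      by (simp add: L2_set_eq_0_iff)
    then show ?thesis using True s_def by simp
  next
    case False
    with s0 have s: "s > 0" by simp
    define \<eta> where "\<eta> = (\<lambda>j. inverse s *\<^sub>R \<xi> j)"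
    have "(\<Sum>j<n. (norm (\<eta> j))\<^sup>2) = (inverse s)\<^sup>2 * (\<Sum>j<n. (norm (\<xi> j))\<^sup>2)"
      using s by (simp add: \<eta>_def power_mult_distrib sum_distrib_left)
    also have "(\<Sum>j<n. (norm (\<xi> j))\<^sup>2) = s\<^sup>2"
      by (simp add: s_def L2_set_def sum_nonneg)
    finally have "(\<Sum>j<n. (norm (\<eta> j))\<^sup>2) = 1" using s by (simp add: field_simps)
    then have *: "L2_set (\<lambda>i. norm (\<Sum>j<n. T i j (\<eta> j))) {..<m} \<le> op_matrix_norm m n T"
      using op_matrix_norm_upper[OF T, where \<xi> = \<eta>] by (simp add: L2_set_def)
    have "(\<Sum>j<n. T i j (\<eta> j)) = inverse s *\<^sub>R (\<Sum>j<n. T i j (\<xi> j))" if "i < m" for i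
      unfolding \<eta>_def scaleR_sum_right using that T
      by (intro sum.cong) (auto simp: linear_scale bounded_linear.linear)
    then have "L2_set (\<lambda>i. norm (\<Sum>j<n. T i j (\<eta> j))) {..<m}
      = L2_set (\<lambda>i. inverse s * norm (\<Sum>j<n. T i j (\<xi> j))) {..<m}"
      using s by (intro L2_set_cong) auto
    also have "\<dots> = inverse s * L2_set (\<lambda>i. norm (\<Sum>j<n. T i j (\<xi> j))) {..<m}"
      using s by (simp add: L2_set_right_distrib)
    finally have "L2_set (\<lambda>i. norm (\<Sum>j<n. T i j (\<xi> j))) {..<m}
      = s * L2_set (\<lambda>i. norm (\<Sum>j<n. T i j (\<eta> j))) {..<m}"
      using s by (simp add: field_simps)
    then show ?thesis using mult_left_mono[OF *, of s] s by (simp add: s_def[symmetric] mult.commute)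
  qed
qed

lemma scalar_matrix_norm_apply:
  "L2_set (\<lambda>i. cmod (\<Sum>j<n. a i j * \<xi> j)) {..<m}
   \<le> scalar_matrix_norm m n a * L2_set (\<lambda>j. cmod (\<xi> j)) {..<n}"
  unfolding scalar_matrix_norm_def by (rule op_matrix_norm_apply) (rule bounded_linear_mult_right)

lemma scalar_matrix_norm_nonneg: "0 \<le> scalar_matrix_norm m n a"
  unfolding scalar_matrix_norm_def by (rule op_matrix_norm_nonneg) (rule bounded_linear_mult_right)

lemma scalar_matrix_norm_le_Frobenius:
  "scalar_matrix_norm m n a \<le> sqrt (\<Sum>i<m. \<Sum>j<n. (cmod (a i j))\<^sup>2)"
  unfolding scalar_matrix_norm_def
proof (rule op_matrix_norm_least, intro real_sqrt_le_mono sum_mono)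
  fix \<xi> :: "nat \<Rightarrow> complex" and i
  assume \<xi>: "(\<Sum>j<n. (norm (\<xi> j))\<^sup>2) \<le> 1"
  have "norm (\<Sum>j<n. a i j * \<xi> j) \<le> (\<Sum>j<n. \<bar>cmod (a i j)\<bar> * \<bar>cmod (\<xi> j)\<bar>)"
    by (rule order_trans[OF norm_sum]) (simp add: norm_mult)
  also have "\<dots> \<le> L2_set (\<lambda>j. cmod (a i j)) {..<n} * L2_set (\<lambda>j. cmod (\<xi> j)) {..<n}"
    by (rule L2_set_mult_ineq)
  also have "\<dots> \<le> L2_set (\<lambda>j. cmod (a i j)) {..<n}"
    using \<xi> by (intro mult_left_le) (auto simp: L2_set_def sum_nonneg)
  finally have "(norm (\<Sum>j<n. a i j * \<xi> j))\<^sup>2 \<le> (L2_set (\<lambda>j. cmod (a i j)) {..<n})\<^sup>2"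
    by (intro power_mono) auto
  then show "(norm (\<Sum>j<n. a i j * \<xi> j))\<^sup>2 \<le> (\<Sum>j<n. (cmod (a i j))\<^sup>2)"
    by (simp add: L2_set_def sum_nonneg)
qed

lemma scalar_matrix_norm_id: "scalar_matrix_norm n n (\<lambda>i j. if i = j then 1 else 0) \<le> 1"
  unfolding scalar_matrix_norm_def
proof (rule op_matrix_norm_least)
  fix \<xi> :: "nat \<Rightarrow> complex"
  assume \<xi>: "(\<Sum>j<n. (norm (\<xi> j))\<^sup>2) \<le> 1"
  have "(\<Sum>j<n. (if i = j then 1 else 0) * \<xi> j) = \<xi> i" if "i < n" for i
    using that by (simp add: if_distrib[of "\<lambda>c. c * _"] cong: if_cong)
  then show "sqrt (\<Sum>i<n. (cmod (\<Sum>j<n. (if i = j then 1 else 0) * \<xi> j))\<^sup>2) \<le> 1"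
    using \<xi> by simp
qed

lemma scalar_matrix_norm_1: "scalar_matrix_norm 1 1 a = cmod (a 0 0)"
proof (rule antisym)
  show "scalar_matrix_norm 1 1 a \<le> cmod (a 0 0)"
    using scalar_matrix_norm_le_Frobenius[of 1 1 a] by simp
  show "cmod (a 0 0) \<le> scalar_matrix_norm 1 1 a"
    using scalar_matrix_norm_apply[where m = 1 and n = 1 and a = a and \<xi> = "\<lambda>_. 1"] by (simp add: L2_set_def)
qed

section \<open>Functions on the strip\<close>

text \<open>A Phragmen-Lindeloef argument: the factor \<open>exp (\<epsilon> (z\<^sup>2 - 1))\<close> is at most \<open>1\<close>
  in modulus on the strip and decays as \<open>|Im z|\<close> grows, so the maximum modulus principle applies on a
  long rectangle; then \<open>\<epsilon>\<close> tends to \<open>0\<close>.\<close>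

lemma three_lines:
  fixes h :: "complex \<Rightarrow> complex"
  assumes cont: "continuous_on strip h" and hol: "h holomorphic_on interior strip"
    and bdd: "\<And>z. z \<in> strip \<Longrightarrow> cmod (h z) \<le> B"
    and left: "\<And>t::real. cmod (h (\<i> * t)) \<le> K" and right: "\<And>t::real. cmod (h (1 + \<i> * t)) \<le> K"
    and K: "K > 0" and z: "z \<in> strip"
  shows "cmod (h z) \<le> K"
proof -
  have ineq: "cmod (h z) \<le> K * cmod (exp (of_real \<epsilon> * (1 - z\<^sup>2)))" if \<epsilon>: "\<epsilon> > 0" for \<epsilon> :: real
  proof -
    define g where "g = (\<lambda>w. h w * exp (of_real \<epsilon> * (w\<^sup>2 - 1)))"
    \<comment> \<open>Beyond height \<open>R\<close> the decay of the factor beats the bound \<open>B\<close>.\<close>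
    define R where "R = max (\<bar>Im z\<bar>) (sqrt (\<bar>B\<bar> / (\<epsilon> * K)))"
    define S where "S = cbox (Complex 0 (-R)) (Complex 1 R)"
    have expn: "cmod (exp (of_real \<epsilon> * (w\<^sup>2 - 1))) \<le> exp (- \<epsilon> * (Im w)\<^sup>2)" if "w \<in> strip" for w
    proof -
      have "(Re w)\<^sup>2 \<le> 1" using that by (simp add: strip_def power_le_one)
      then have "Re (of_real \<epsilon> * (w\<^sup>2 - 1)) \<le> - \<epsilon> * (Im w)\<^sup>2"
        using \<epsilon> by (simp add: power2_eq_square algebra_simps mult_left_le)
      then show ?thesis by simp
    qed
    have far: "\<bar>B\<bar> * exp (- \<epsilon> * R\<^sup>2) \<le> K"
    proof -
      have "\<bar>B\<bar> / (\<epsilon> * K) \<le> R\<^sup>2"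
        by (rule sqrt_le_D) (simp add: R_def)
      then have "\<bar>B\<bar> / K \<le> \<epsilon> * R\<^sup>2" using \<epsilon> K by (simp add: field_simps)
      also have "\<dots> \<le> exp (\<epsilon> * R\<^sup>2)" using exp_ge_add_one_self[of "\<epsilon> * R\<^sup>2"] by linarith
      finally show ?thesis using K by (simp add: exp_minus field_simps)
    qed
    have Sstrip: "S \<subseteq> strip" by (auto simp: S_def strip_def in_cbox_complex_iff)
    have "cmod (g z) \<le> K"
    proof (rule maximum_modulus_frontier[of g S])
      show "g holomorphic_on interior S"
        unfolding g_def using Sstrip interior_mono
        by (intro holomorphic_intros holomorphic_on_subset[OF hol]) blast
      show "continuous_on (closure S) g"
        unfolding g_def using Sstrip
        by (intro continuous_intros continuous_on_subset[OF cont]) (simp add: S_def)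
      show "bounded S" by (simp add: S_def)
      show "z \<in> S" using z by (auto simp: S_def strip_def in_cbox_complex_iff R_def)
      fix w assume "w \<in> frontier S"
      then have w: "w \<in> S" "w \<notin> box (Complex 0 (-R)) (Complex 1 R)"
        by (auto simp: frontier_def S_def)
      then have ws: "w \<in> strip" using Sstrip by auto
      have gw: "cmod (g w) \<le> cmod (h w) * exp (- \<epsilon> * (Im w)\<^sup>2)"
        unfolding g_def norm_mult by (intro mult_left_mono expn ws) auto
      from w have "Re w = 0 \<or> Re w = 1 \<or> \<bar>Im w\<bar> = R"
        by (auto simp: S_def in_cbox_complex_iff in_box_complex_iff)
      then show "cmod (g w) \<le> K"
      proof (elim disjE)
        assume "\<bar>Im w\<bar> = R"
        then have "(Im w)\<^sup>2 = R\<^sup>2" by (metis power2_abs)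
        moreover have "cmod (h w) * exp (- \<epsilon> * (Im w)\<^sup>2) \<le> \<bar>B\<bar> * exp (- \<epsilon> * (Im w)\<^sup>2)"
          using bdd[OF ws] by (intro mult_right_mono) auto
        ultimately show ?thesis using gw far by (metis order_trans)
      next
        assume "Re w = 0"
        then have "w = \<i> * of_real (Im w)" by (simp add: complex_eq_iff)
        then have "cmod (h w) \<le> K" using left by metis
        moreover have "exp (- \<epsilon> * (Im w)\<^sup>2) \<le> 1" using \<epsilon> by simp
        ultimately have "cmod (h w) * exp (- \<epsilon> * (Im w)\<^sup>2) \<le> K * 1" using K by (intro mult_mono) auto
        then show ?thesis using gw by simp
      next
        assume "Re w = 1"
        then have "w = 1 + \<i> * of_real (Im w)" by (simp add: complex_eq_iff)
        then have "cmod (h w) \<le> K" using right by metis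
        moreover have "exp (- \<epsilon> * (Im w)\<^sup>2) \<le> 1" using \<epsilon> by simp
        ultimately have "cmod (h w) * exp (- \<epsilon> * (Im w)\<^sup>2) \<le> K * 1" using K by (intro mult_mono) auto
        then show ?thesis using gw by simp
      qed
    qed
    moreover have "h z = g z * exp (of_real \<epsilon> * (1 - z\<^sup>2))"
      by (simp add: g_def mult_exp_exp algebra_simps)
    ultimately show ?thesis by (simp add: norm_mult mult_right_mono del: norm_exp_eq_Re)
  qed
  have "((\<lambda>\<epsilon>::real. K * cmod (exp (of_real \<epsilon> * (1 - z\<^sup>2)))) \<longlongrightarrow> K * cmod (exp (of_real 0 * (1 - z\<^sup>2)))) (at_right 0)"
    by (intro tendsto_intros)
  moreover have "\<forall>\<^sub>F \<epsilon> in at_right (0::real). cmod (h z) \<le> K * cmod (exp (of_real \<epsilon> * (1 - z\<^sup>2)))"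
    using ineq by (auto simp: eventually_at_right_field intro!: exI[of _ 1])
  ultimately have "cmod (h z) \<le> K * cmod (exp (of_real 0 * (1 - z\<^sup>2)))"
    by (intro tendsto_lowerbound[of _ _ "at_right (0::real)"]) auto
  then show ?thesis by simp
qed

lemma interior_strip: "interior strip = {z. 0 < Re z \<and> Re z < 1}"
proof -
  have "strip = {z. 0 \<le> Re z} \<inter> {z. Re z \<le> 1}" by (auto simp: strip_def)
  then have "interior strip = interior {z. 0 \<le> Re z} \<inter> interior {z. Re z \<le> 1}" by (metis interior_Int)
  also have "\<dots> = {z. 0 < Re z} \<inter> {z. Re z < 1}"
    using interior_halfspace_ge[of "1::complex" 0] interior_halfspace_le[of "1::complex" 1] by (simp add: inner_complex_def)
  finally show ?thesis by auto
qed

text \<open>Cauchy's estimate on the closed disc of radius \<open>1/2\<close> about \<open>1/2\<close>, which touches both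
  sides of the strip.\<close>

lemma strip_derivative_bound:
  fixes h :: "complex \<Rightarrow> complex"
  assumes cont: "continuous_on strip h" and hol: "h holomorphic_on interior strip"
    and bdd: "\<And>z. z \<in> strip \<Longrightarrow> cmod (h z) \<le> B"
    and left: "\<And>t::real. cmod (h (\<i> * t)) \<le> K" and right: "\<And>t::real. cmod (h (1 + \<i> * t)) \<le> K"
    and K: "K > 0"
  shows "cmod (deriv h (1/2)) \<le> 2 * K"
proof -
  have cb: "cball (1/2) (1/2) \<subseteq> strip"
  proof
    fix z :: complex assume "z \<in> cball (1/2) (1/2)"
    then have "\<bar>Re (1/2 - z)\<bar> \<le> 1/2"
      using abs_Re_le_cmod[of "1/2 - z"] by (simp add: dist_norm)
    then show "z \<in> strip" unfolding strip_def by (simp add: abs_if split: if_splits)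
  qed
  have "norm ((deriv ^^ 1) h (1/2)) \<le> fact 1 * K / (1/2)^1"
  proof (rule Cauchy_inequality)
    show "h holomorphic_on ball (1/2) (1/2)"
      using interior_mono[OF cb] by (intro holomorphic_on_subset[OF hol]) simp
    show "continuous_on (cball (1/2) (1/2)) h" by (rule continuous_on_subset[OF cont cb])
    fix z :: complex assume "norm (1/2 - z) = 1/2"
    then have "z \<in> strip" using cb by (auto simp: dist_norm)
    then show "norm (h z) \<le> K" using three_lines[OF cont hol bdd left right K] by blast
  qed simp
  then show ?thesis by simp
qed

section \<open>The space of square summable sequences\<close>

abbreviation chi :: "nat set \<Rightarrow> nat \<Rightarrow> complex" where
  "chi K \<equiv> indicator K"

lemma scaleC_zero_left [simp]: "0 *\<^sub>C x = 0"
  using scaleC_add_left[of 0 0 x] by simp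

lemma scaleC_zero_right [simp]: "c *\<^sub>C 0 = 0"
  using scaleC_add_right[of c 0 0] by simp

lemma scaleC_apply [simp]: "(c *\<^sub>C x) k = c *\<^sub>C x k"
  by (simp add: scaleC_fun_def)

declare scaleC_complex_def [simp]

lemma sum_fun_apply: "(\<Sum>k<n. g k) j = (\<Sum>k<(n::nat). g k j)"
  by (induction n) simp_all

lemma ell2_add: "x \<in> vset ell2 \<Longrightarrow> y \<in> vset ell2 \<Longrightarrow> x + y \<in> vset ell2"
proof -
  assume "x \<in> vset ell2" "y \<in> vset ell2"
  then have "summable (\<lambda>k. 2 * (cmod (x k))\<^sup>2 + 2 * (cmod (y k))\<^sup>2)"
    by (intro summable_add summable_mult) (auto simp: ell2_def)
  moreover have "(cmod (x k + y k))\<^sup>2 \<le> 2 * (cmod (x k))\<^sup>2 + 2 * (cmod (y k))\<^sup>2" for k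
  proof -
    have "(cmod (x k + y k))\<^sup>2 \<le> (cmod (x k) + cmod (y k))\<^sup>2"
      by (intro power_mono norm_triangle_ineq) simp
    also have "\<dots> \<le> 2 * (cmod (x k))\<^sup>2 + 2 * (cmod (y k))\<^sup>2"
      using sum_squares_bound[of "cmod (x k)" "cmod (y k)"] by (simp add: power2_sum)
    finally show ?thesis .
  qed
  ultimately have "summable (\<lambda>k. (cmod (x k + y k))\<^sup>2)"
    by (auto intro: summable_comparison_test')
  then show ?thesis by (simp add: ell2_def)
qed

lemma ell2_scale: "x \<in> vset ell2 \<Longrightarrow> c *\<^sub>C x \<in> vset ell2"
  by (auto simp: ell2_def norm_mult power_mult_distrib intro: summable_mult)

lemma ell2_zero: "0 \<in> vset ell2"
  by (simp add: ell2_def)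

lemma ell2_diff: "x \<in> vset ell2 \<Longrightarrow> y \<in> vset ell2 \<Longrightarrow> x - y \<in> vset ell2"
proof -
  assume "x \<in> vset ell2" "y \<in> vset ell2"
  moreover have "x - y = x + (- 1) *\<^sub>C y" by (simp add: fun_eq_iff)
  ultimately show ?thesis using ell2_add ell2_scale by metis
qed

lemma ell2_norm_nonneg: "x \<in> vset ell2 \<Longrightarrow> 0 \<le> vnorm ell2 x"
  by (simp add: ell2_def suminf_nonneg)

text \<open>Every vector whose norm has to be computed exactly has finite support.\<close>

lemma ell2_finite_support:
  assumes "finite K" "\<And>k. k \<notin> K \<Longrightarrow> x k = 0"
  shows "x \<in> vset ell2" "vnorm ell2 x = L2_set (\<lambda>k. cmod (x k)) K"
  using summable_finite[of K "\<lambda>k. (cmod (x k))\<^sup>2"] suminf_finite[of K "\<lambda>k. (cmod (x k))\<^sup>2"] assms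
  by (auto simp: ell2_def L2_set_def)

lemma chi_ell2: "finite K \<Longrightarrow> c *\<^sub>C chi K \<in> vset ell2"
  by (rule ell2_finite_support) auto

lemma norm_chi:
  assumes "finite K"
  shows "vnorm ell2 (c *\<^sub>C chi K) = cmod c * sqrt (card K)"
proof -
  have "vnorm ell2 (c *\<^sub>C chi K) = L2_set (\<lambda>k. cmod ((c *\<^sub>C chi K) k)) K"
    by (rule ell2_finite_support) (use assms in auto)
  also have "\<dots> = L2_set (\<lambda>k. cmod c) K" by (intro L2_set_cong) auto
  finally show ?thesis by (simp add: L2_set_def real_sqrt_mult)
qed

lemma L2_set_le_ell2_norm: "x \<in> vset ell2 \<Longrightarrow> L2_set (\<lambda>k. cmod (x k)) K \<le> vnorm ell2 x"
  by (cases "finite K") (auto simp: L2_set_def ell2_def suminf_nonneg intro!: sum_le_suminf)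

text \<open>The pairing with the unit vector in the direction of \<open>chi K\<close>. For a singleton it is a
  coordinate, and for \<open>K = {}\<close> the division by zero makes it the zero functional.\<close>

definition avg :: "nat set \<Rightarrow> (nat \<Rightarrow> complex) \<Rightarrow> complex" where
  "avg K x = (\<Sum>k\<in>K. x k) / sqrt (card K)"

lemma avg_add: "avg K (x + y) = avg K x + avg K y"
  by (simp add: avg_def sum.distrib add_divide_distrib)

lemma avg_diff: "avg K (x - y) = avg K x - avg K y"
  by (simp add: avg_def sum_subtractf diff_divide_distrib)

lemma avg_scale: "avg K (c *\<^sub>C x) = c * avg K x"
  by (simp add: avg_def sum_distrib_left)

lemma avg_chi: "finite K \<Longrightarrow> avg K (chi K) = sqrt (card K)"
proof -
  assume "finite K"
  then have "avg K (chi K) = of_real (real (card K) / sqrt (card K))"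
    by (simp add: avg_def)
  also have "real (card K) / sqrt (card K) = sqrt (card K)" by (rule real_div_sqrt) simp
  finally show ?thesis .
qed

lemma avg_dual: "avg K \<in> dual_ball ell2"
  unfolding dual_ball_def
proof (safe; (simp only: avg_add avg_scale)?)
  fix x assume x: "x \<in> vset ell2"
  have "cmod (\<Sum>k\<in>K. x k) \<le> (\<Sum>k\<in>K. \<bar>cmod (x k)\<bar> * \<bar>1\<bar>)" by (simp add: norm_sum)
  also have "\<dots> \<le> L2_set (\<lambda>k. cmod (x k)) K * L2_set (\<lambda>k. 1) K" by (rule L2_set_mult_ineq)
  also have "\<dots> \<le> vnorm ell2 x * sqrt (card K)"
    using L2_set_le_ell2_norm[OF x] by (auto simp: L2_set_def intro!: mult_right_mono)
  finally have "cmod (\<Sum>k\<in>K. x k) \<le> vnorm ell2 x * sqrt (card K)" .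
  then show "cmod (avg K x) \<le> vnorm ell2 x"
    using ell2_norm_nonneg[OF x]
    by (cases "card K = 0") (auto simp: avg_def norm_divide field_simps)
qed

lemma dual_ballD:
  assumes "f \<in> dual_ball ell2"
  shows "x \<in> vset ell2 \<Longrightarrow> y \<in> vset ell2 \<Longrightarrow> f (x + y) = f x + f y"
    and "x \<in> vset ell2 \<Longrightarrow> f (c *\<^sub>C x) = c * f x"
    and "x \<in> vset ell2 \<Longrightarrow> cmod (f x) \<le> vnorm ell2 x"
  using assms by (auto simp: dual_ball_def)

lemma dual_ball_0: "f \<in> dual_ball ell2 \<Longrightarrow> f 0 = 0"
  using dual_ballD(2)[of f 0 0] ell2_zero by simp

lemma dual_ball_sum:
  assumes f: "f \<in> dual_ball ell2" and x: "\<And>k. k < (n::nat) \<Longrightarrow> x k \<in> vset ell2"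
  shows "(\<Sum>k<n. c k *\<^sub>C x k) \<in> vset ell2 \<and> f (\<Sum>k<n. c k *\<^sub>C x k) = (\<Sum>k<n. c k * f (x k))"
  using x
proof (induction n)
  case (Suc n)
  let ?v = "\<Sum>k<n. c k *\<^sub>C x k"
  have v: "?v \<in> vset ell2" "f ?v = (\<Sum>k<n. c k * f (x k))" using Suc by (blast intro: less_SucI)+
  have xn: "x n \<in> vset ell2" using Suc.prems by blast
  have "f (?v + c n *\<^sub>C x n) = (\<Sum>k<n. c k * f (x k)) + c n * f (x n)"
    by (simp only: dual_ballD(1)[OF f v(1) ell2_scale[OF xn]] dual_ballD(2)[OF f xn] v(2))
  then show ?case
    unfolding sum.lessThan_Suc using ell2_add[OF v(1) ell2_scale[OF xn]] by blast
qed (simp add: ell2_zero dual_ball_0[OF f])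

text \<open>For the vector \<open>v\<close> with coordinates \<open>cnj (f e\<^sub>k)\<close>, \<open>k < n\<close>, the number \<open>f v\<close> is the
  sum \<open>S\<close> of the \<open>|f e\<^sub>k|\<^sup>2\<close>, whereas \<open>\<parallel>v\<parallel> = \<surd>S\<close>.\<close>

lemma dual_ball_Bessel:
  assumes f: "f \<in> dual_ball ell2"
  shows "(\<Sum>k<n. (cmod (f (c *\<^sub>C chi {k})))\<^sup>2) \<le> (cmod c)\<^sup>2"
proof -
  define S where "S = (\<Sum>k<n. (cmod (f (chi {k})))\<^sup>2)"
  define v where "v = (\<Sum>k<n. cnj (f (chi {k})) *\<^sub>C chi {k})"
  have S0: "S \<ge> 0" by (simp add: S_def sum_nonneg)
  have e: "chi {k} \<in> vset ell2" for k by (rule ell2_finite_support[of "{k}"]) auto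
  have *: "v \<in> vset ell2 \<and> f v = (\<Sum>k<n. cnj (f (chi {k})) * f (chi {k}))"
    unfolding v_def by (rule dual_ball_sum[OF f e])
  then have v: "v \<in> vset ell2" and fv: "f v = of_real S"
    by (auto simp: S_def complex_norm_square mult.commute simp flip: of_real_power)
  have vk: "v k = (if k < n then cnj (f (chi {k})) else 0)" for k
  proof -
    have "v k = (\<Sum>j<n. cnj (f (chi {j})) * chi {j} k)"
      by (simp add: v_def sum_fun_apply)
    also have "\<dots> = (\<Sum>j<n. if j = k then cnj (f (chi {j})) else 0)"
      by (intro sum.cong) auto
    finally show ?thesis by simp
  qed
  have "vnorm ell2 v = L2_set (\<lambda>k. cmod (v k)) {..<n}"
    by (rule ell2_finite_support) (auto simp: vk)
  also have "\<dots> = sqrt S" by (simp add: L2_set_def S_def vk)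
  finally have "S \<le> sqrt S" using dual_ballD(3)[OF f v] S0 by (simp add: fv)
  then have "S * S \<le> sqrt S * sqrt S" using S0 by (intro mult_mono) auto
  then have SS: "S * S \<le> S" using S0 by simp
  have "S \<le> 1"
  proof (rule ccontr)
    assume "\<not> S \<le> 1"
    then have "S * 1 < S * S" by (intro mult_strict_left_mono) auto
    with SS show False by simp
  qed
  moreover have "(\<Sum>k<n. (cmod (f (c *\<^sub>C chi {k})))\<^sup>2) = (cmod c)\<^sup>2 * S"
    by (simp add: dual_ballD(2)[OF f e] S_def sum_distrib_left norm_mult power_mult_distrib)
  ultimately show ?thesis by (simp add: mult_left_le)
qed

section \<open>The couple at the level of vectors\<close>

text \<open>On single vectors the two ends of the couple, and their sum, carry the norm of \<open>\<ell>\<^sub>2\<close>. The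
  lemmas below give two halves of this: a functional in the dual ball is bounded by each of the three
  norms, and each of them is bounded by the norm of \<open>\<ell>\<^sub>2\<close>. They meet on multiples of \<open>chi K\<close>,
  where \<open>avg K\<close> attains the norm.\<close>

abbreviation "X0 \<equiv> base (min_os ell2)"
abbreviation "X1 \<equiv> base (max_os ell2)"
abbreviation "XS \<equiv> sum_nspace X0 X1"

lemma zero_dual_ball: "(\<lambda>_. 0) \<in> dual_ball ell2"
  by (simp add: dual_ball_def ell2_norm_nonneg)

lemma vset_X [simp]: "vset X0 = vset ell2" "vset X1 = vset ell2"
  by (simp_all add: base_def min_os_def max_os_def)

lemma vset_XS [simp]: "vset XS = vset ell2"
  using ell2_add ell2_zero by (force simp: sum_nspace_def)

lemma min_norm_upper:
  assumes "\<And>f. f \<in> dual_ball ell2 \<Longrightarrow> scalar_matrix_norm n n (\<lambda>i j. f (x i j)) \<le> B"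
  shows "mnorm (min_os ell2) n x \<le> B"
  unfolding min_os_def using assms zero_dual_ball by (auto intro!: cSup_least)

lemma min_norm_lower:
  assumes "\<And>i j. i < n \<Longrightarrow> j < n \<Longrightarrow> x i j \<in> vset ell2" "f \<in> dual_ball ell2"
  shows "scalar_matrix_norm n n (\<lambda>i j. f (x i j)) \<le> mnorm (min_os ell2) n x"
proof -
  have "scalar_matrix_norm n n (\<lambda>i j. g (x i j)) \<le> sqrt (\<Sum>i<n. \<Sum>j<n. (vnorm ell2 (x i j))\<^sup>2)"
    if "g \<in> dual_ball ell2" for g
    by (rule order_trans[OF scalar_matrix_norm_le_Frobenius])
       (intro real_sqrt_le_mono sum_mono power_mono dual_ballD(3)[OF that] assms; simp)
  then have "bdd_above {scalar_matrix_norm n n (\<lambda>i j. f (x i j)) |f. f \<in> dual_ball ell2}"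
    by (auto intro!: bdd_aboveI)
  then show ?thesis unfolding min_os_def using assms(2) by (auto intro!: cSup_upper)
qed

lemma max_norm_upper:
  assumes "\<And>k. k < N \<Longrightarrow> d k \<in> vset ell2"
    and "\<And>i j. i < n \<Longrightarrow> j < n \<Longrightarrow> x i j = (\<Sum>k<N. (A i k * B k j) *\<^sub>C d k)"
    and "scalar_matrix_norm n N A \<le> a" "\<And>k. k < N \<Longrightarrow> vnorm ell2 (d k) \<le> D" "0 \<le> D"
      "scalar_matrix_norm N n B \<le> b"
  shows "mnorm (max_os ell2) n x \<le> a * D * b"
proof -
  have a: "a \<ge> 0" using assms(3) scalar_matrix_norm_nonneg order_trans by blast
  let ?M = "Max (insert 0 ((\<lambda>k. vnorm ell2 (d k)) ` {..<N}))"
  have "mnorm (max_os ell2) n x \<le> scalar_matrix_norm n N A * ?M * scalar_matrix_norm N n B"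
    unfolding max_os_def opspace.simps
  proof (rule cInf_lower)
    show "bdd_below {scalar_matrix_norm n N A * Max (insert 0 ((\<lambda>k. vnorm ell2 (d k)) ` {..<N}))
        * scalar_matrix_norm N n B | N A d B. (\<forall>k<N. d k \<in> vset ell2) \<and>
          (\<forall>i<n. \<forall>j<n. x i j = (\<Sum>k<N. (A i k * B k j) *\<^sub>C d k))}"
      by (rule bdd_belowI[of _ 0]) (auto intro!: mult_nonneg_nonneg scalar_matrix_norm_nonneg)
  qed (use assms(1,2) in blast)
  also have "\<dots> \<le> a * D * b"
    using assms a by (intro mult_mono mult_nonneg_nonneg scalar_matrix_norm_nonneg) auto
  finally show ?thesis .
qed

text \<open>For a factorization \<open>x = A D B\<close>, the number \<open>f (x 0 0)\<close> is the product of the row \<open>A\<close>,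
  the diagonal matrix of the \<open>f (d k)\<close>, and the column \<open>B\<close>.\<close>

lemma max_norm_1_lower:
  assumes "x 0 0 \<in> vset ell2" "f \<in> dual_ball ell2"
  shows "cmod (f (x 0 0)) \<le> mnorm (max_os ell2) 1 x"
  unfolding max_os_def
proof (simp only: opspace.simps, rule cInf_greatest, goal_cases)
  case 1
  have "\<exists>(N::nat) A d B. (\<forall>k<N. d k \<in> vset ell2) \<and> (\<forall>i<1. \<forall>j<1. x i j = (\<Sum>k<N. (A i k * B k j) *\<^sub>C d k))"
  proof (rule exI[of _ 1], rule exI[of _ "\<lambda>_ _. 1"], rule exI[of _ "\<lambda>_. x 0 0"], rule exI[of _ "\<lambda>_ _. 1"])
    show "(\<forall>k<1. x 0 0 \<in> vset ell2) \<and> (\<forall>i<1. \<forall>j<1. x i j = (\<Sum>k<(1::nat). (1 * 1) *\<^sub>C x 0 0))"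
      using assms(1) by (simp add: scaleC_one)
  qed
  then obtain N :: nat and A d B where "\<forall>k<N. d k \<in> vset ell2"
    and "\<forall>i<1. \<forall>j<1. x i j = (\<Sum>k<N. (A i k * B k j) *\<^sub>C d k)" by (elim exE conjE)
  then show ?case by (intro ex_in_conv[THEN iffD1] exI CollectI conjI) (rule refl, assumption, assumption)
next
  case (2 r)
  then obtain N A d B where r: "r = scalar_matrix_norm 1 N A * Max (insert 0 ((\<lambda>k. vnorm ell2 (d k)) ` {..<N})) * scalar_matrix_norm N 1 B"
    and d: "\<And>k. k < N \<Longrightarrow> d k \<in> vset ell2" and x: "x 0 0 = (\<Sum>k<N. (A 0 k * B k 0) *\<^sub>C d k)"
    by auto
  define D where "D = Max (insert 0 ((\<lambda>k. vnorm ell2 (d k)) ` {..<N}))"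
  have D: "vnorm ell2 (d k) \<le> D" if "k < N" for k
    unfolding D_def using that by (intro Max_ge) auto
  have D0: "0 \<le> D" unfolding D_def by (intro Max_ge) auto
  have "cmod (f (x 0 0)) = cmod (\<Sum>k<N. A 0 k * (B k 0 * f (d k)))"
    using dual_ball_sum[OF assms(2) d, where c = "\<lambda>k. A 0 k * B k 0"] by (simp add: x mult.assoc)
  also have "\<dots> \<le> scalar_matrix_norm 1 N A * L2_set (\<lambda>k. cmod (B k 0 * f (d k))) {..<N}"
    using scalar_matrix_norm_apply[where m = 1 and n = N and a = A and \<xi> = "\<lambda>k. B k 0 * f (d k)"]
    by (simp add: lessThan_Suc)
  also have "\<dots> \<le> scalar_matrix_norm 1 N A * L2_set (\<lambda>k. D * cmod (B k 0)) {..<N}"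
    using order_trans[OF dual_ballD(3)[OF assms(2) d] D]
    by (intro mult_left_mono L2_set_mono scalar_matrix_norm_nonneg)
       (auto simp: norm_mult mult.commute[of D] intro!: mult_left_mono)
  also have "\<dots> = scalar_matrix_norm 1 N A * (D * L2_set (\<lambda>k. cmod (B k 0)) {..<N})"
    by (simp add: L2_set_right_distrib D0)
  also have "\<dots> \<le> scalar_matrix_norm 1 N A * (D * scalar_matrix_norm N 1 B)"
    using scalar_matrix_norm_apply[where m = N and n = 1 and a = B and \<xi> = "\<lambda>_. 1"] D0
    by (intro mult_left_mono scalar_matrix_norm_nonneg) (auto simp: L2_set_def)
  finally show ?case by (simp add: r D_def mult.assoc)
qed

lemma functional_le_X0: "x \<in> vset ell2 \<Longrightarrow> f \<in> dual_ball ell2 \<Longrightarrow> cmod (f x) \<le> vnorm X0 x"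
  using min_norm_lower[of 1 "\<lambda>i j. if i = 0 \<and> j = 0 then x else 0" f]
  unfolding scalar_matrix_norm_1 by (simp add: base_def)

lemma functional_le_X1: "x \<in> vset ell2 \<Longrightarrow> f \<in> dual_ball ell2 \<Longrightarrow> cmod (f x) \<le> vnorm X1 x"
  using max_norm_1_lower[of "\<lambda>i j. if i = 0 \<and> j = 0 then x else 0" f] by (simp add: base_def)

lemma functional_le_XS:
  assumes "x \<in> vset ell2" "f \<in> dual_ball ell2"
  shows "cmod (f x) \<le> vnorm XS x"
  unfolding sum_nspace_def
proof (simp, rule cInf_greatest, goal_cases)
  case 1
  show ?case using assms(1) ell2_zero by force
next
  case (2 r)
  then obtain y z where "r = vnorm X0 y + vnorm X1 z" and yz: "y \<in> vset ell2" "z \<in> vset ell2" "x = y + z" by auto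
  then show ?case
    using dual_ballD(1)[OF assms(2), of y z] norm_triangle_ineq[of "f y" "f z"]
      functional_le_X0[of y f] functional_le_X1[of z f] assms(2) by simp
qed

lemma X0_le: "x \<in> vset ell2 \<Longrightarrow> vnorm X0 x \<le> vnorm ell2 x"
  unfolding base_def
  by (simp, rule min_norm_upper) (simp only: scalar_matrix_norm_1[simplified], simp add: dual_ballD)

lemma X1_le: "x \<in> vset ell2 \<Longrightarrow> vnorm X1 x \<le> vnorm ell2 x"
  using max_norm_upper[of 1 "\<lambda>_. x" 1 "\<lambda>i j. if i = 0 \<and> j = 0 then x else 0" "\<lambda>i j. if i = j then 1 else 0"
      "\<lambda>i j. if i = j then 1 else 0" 1 "vnorm ell2 x" 1] scalar_matrix_norm_id[of 1]
  by (simp add: base_def scaleC_one ell2_norm_nonneg)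

lemma XS_le:
  assumes x: "x \<in> vset ell2"
  shows "vnorm XS x \<le> vnorm ell2 x"
proof -
  have nn: "0 \<le> vnorm X0 y" "0 \<le> vnorm X1 y" if "y \<in> vset ell2" for y
    using functional_le_X0[OF that zero_dual_ball] functional_le_X1[OF that zero_dual_ball] by simp_all
  have "vnorm XS x \<le> vnorm X0 x + vnorm X1 0"
    unfolding sum_nspace_def nspace.simps
  proof (rule cInf_lower)
    show "vnorm X0 x + vnorm X1 0
        \<in> {vnorm X0 y + vnorm X1 z | y z. y \<in> vset X0 \<and> z \<in> vset X1 \<and> x = y + z}"
      using x ell2_zero by force
    show "bdd_below {vnorm X0 y + vnorm X1 z | y z. y \<in> vset X0 \<and> z \<in> vset X1 \<and> x = y + z}"
      by (rule bdd_belowI[of _ 0]) (use nn in auto)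
  qed
  also have "\<dots> \<le> vnorm ell2 x + vnorm ell2 0"
    by (intro add_mono X0_le X1_le x ell2_zero)
  finally show ?thesis by (simp add: ell2_def)
qed

lemma base_norm_chi:
  assumes "finite K"
  shows "vnorm X0 (c *\<^sub>C chi K) = cmod c * sqrt (card K)" "vnorm X1 (c *\<^sub>C chi K) = cmod c * sqrt (card K)"
    "vnorm XS (c *\<^sub>C chi K) = cmod c * sqrt (card K)"
proof -
  note c = chi_ell2[OF assms, of c]
  have "cmod (avg K (c *\<^sub>C chi K)) = cmod c * sqrt (card K)"
    by (simp add: avg_scale avg_chi assms norm_mult)
  then show "vnorm X0 (c *\<^sub>C chi K) = cmod c * sqrt (card K)" "vnorm X1 (c *\<^sub>C chi K) = cmod c * sqrt (card K)"
    "vnorm XS (c *\<^sub>C chi K) = cmod c * sqrt (card K)"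
    using functional_le_X0[OF c avg_dual[of K]] functional_le_X1[OF c avg_dual[of K]] functional_le_XS[OF c avg_dual[of K]]
      X0_le[OF c] X1_le[OF c] XS_le[OF c] by (simp_all add: norm_chi assms)
qed

section \<open>Liftings of indicator vectors\<close>

text \<open>The exponential that is \<open>1\<close> at \<open>1/2\<close> and has modulus \<open>exp (- b / 2)\<close> and
  \<open>exp (b / 2)\<close> on the two sides of the strip.\<close>

definition expo :: "real \<Rightarrow> complex \<Rightarrow> complex" where
  "expo b z = exp (of_real b * (z - 1/2))"

definition chi_lift :: "real \<Rightarrow> nat set \<Rightarrow> complex \<Rightarrow> nat \<Rightarrow> complex" where
  "chi_lift b K = (\<lambda>z. if z \<in> strip then expo b z *\<^sub>C chi K else 0)"

lemma norm_expo: "cmod (expo b z) = exp (b * (Re z - 1/2))"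
  by (simp add: expo_def)

lemma continuous_expo: "continuous_on UNIV (expo b)"
  unfolding expo_def by (intro continuous_intros)

lemma has_cderiv_chi_lift:
  assumes K: "finite K" and z: "z \<in> interior strip"
  shows "has_cderiv XS (chi_lift b K) ((of_real b * expo b z) *\<^sub>C chi K) z"
  unfolding has_cderiv_def
proof
  show "(of_real b * expo b z) *\<^sub>C chi K \<in> vset XS" using chi_ell2[OF K] by simp
  let ?r = "\<lambda>w. (expo b w - expo b z) / (w - z) - of_real b * expo b z"
  have "(expo b has_field_derivative of_real b * expo b z) (at z)"
    unfolding expo_def by (auto intro!: derivative_eq_intros)
  then have "(?r \<longlongrightarrow> 0) (at z)"
    unfolding has_field_derivative_iff LIM_zero_iff .
  then have "((\<lambda>w. cmod (?r w) * sqrt (card K)) \<longlongrightarrow> 0 * sqrt (card K)) (at z)"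
    by (intro tendsto_mult tendsto_norm_zero tendsto_const)
  moreover have "\<forall>\<^sub>F w in at z. w \<in> interior strip"
    using z by (intro eventually_at_topological[THEN iffD2]) (auto intro: open_interior)
  then have "\<forall>\<^sub>F w in at z. cmod (?r w) * sqrt (card K)
    = vnorm XS (inverse (w - z) *\<^sub>C (chi_lift b K w - chi_lift b K z) - (of_real b * expo b z) *\<^sub>C chi K)"
  proof eventually_elim
    case (elim w)
    have "inverse (w - z) *\<^sub>C (chi_lift b K w - chi_lift b K z) - (of_real b * expo b z) *\<^sub>C chi K = ?r w *\<^sub>C chi K"
      using elim z interior_subset[of strip] by (auto simp: chi_lift_def fun_eq_iff field_simps)
    then show ?case by (simp only: base_norm_chi[OF K])
  qed
  ultimately show "((\<lambda>w. vnorm XS (inverse (w - z) *\<^sub>C (chi_lift b K w - chi_lift b K z) - (of_real b * expo b z) *\<^sub>C chi K)) \<longlongrightarrow> 0) (at z)"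
    using Lim_transform_eventually by fastforce
qed

lemma chi_lift_in_calderon:
  assumes K: "finite K"
  shows "chi_lift b K \<in> vset (calderon X0 X1)"
proof -
  have val: "chi_lift b K z = expo b z *\<^sub>C chi K" if "z \<in> strip" for z using that by (simp add: chi_lift_def)
  have line: "\<i> * of_real t \<in> strip" "1 + \<i> * of_real t \<in> strip" for t by (auto simp: strip_def)
  have bound: "exp (b * (Re z - 1/2)) \<le> exp \<bar>b\<bar>" if "z \<in> strip" for z
  proof -
    have "b * (Re z - 1/2) \<le> \<bar>b\<bar> * \<bar>Re z - 1/2\<bar>" by (simp flip: abs_mult)
    also have "\<dots> \<le> \<bar>b\<bar> * 1" using that by (intro mult_left_mono) (auto simp: strip_def abs_le_iff)
    finally show ?thesis by simp
  qed
  have cont: "((\<lambda>w. vnorm XS (chi_lift b K w - chi_lift b K z)) \<longlongrightarrow> 0) (at z within strip)" if z: "z \<in> strip" for z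
  proof -
    have "(expo b \<longlongrightarrow> expo b z) (at z within strip)"
      using continuous_on_subset[OF continuous_expo, of strip] z by (simp add: continuous_on_def)
    then have "((\<lambda>w. cmod (expo b w - expo b z) * sqrt (card K)) \<longlongrightarrow> 0 * sqrt (card K)) (at z within strip)"
      by (intro tendsto_mult tendsto_norm_zero tendsto_const) (simp add: LIM_zero_iff)
    moreover have "\<forall>\<^sub>F w in at z within strip. cmod (expo b w - expo b z) * sqrt (card K) = vnorm XS (chi_lift b K w - chi_lift b K z)"
      unfolding eventually_at_filter
    proof (intro always_eventually allI impI)
      fix w assume "w \<in> strip"
      then have "chi_lift b K w - chi_lift b K z = (expo b w - expo b z) *\<^sub>C chi K"
        using z by (simp add: chi_lift_def fun_eq_iff algebra_simps)
      then show "cmod (expo b w - expo b z) * sqrt (card K) = vnorm XS (chi_lift b K w - chi_lift b K z)"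
        by (simp only: base_norm_chi[OF K])
    qed
    ultimately show ?thesis using Lim_transform_eventually by fastforce
  qed
  have "bdd_above ((\<lambda>z. vnorm XS (chi_lift b K z)) ` strip)"
    using bound by (intro bdd_aboveI[of _ "exp \<bar>b\<bar> * sqrt (card K)"])
      (auto simp: val base_norm_chi[OF K] norm_expo intro!: mult_right_mono)
  moreover have "chi_lift b K z \<in> vset ell2" if "z \<in> strip" for z using chi_ell2[OF K] val[OF that] by simp
  ultimately show ?thesis
    unfolding calderon_def Let_def
    using cont has_cderiv_chi_lift[OF K] chi_ell2[OF K]
    by (auto simp: val line base_norm_chi[OF K] norm_expo simp del: vset_XS simp add: vset_XS) (auto simp: chi_lift_def)
qed

lemma calderonD:
  assumes "f \<in> vset (calderon X0 X1)"
  shows "\<And>z. z \<in> strip \<Longrightarrow> f z \<in> vset ell2"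
    and "bdd_above ((\<lambda>z. vnorm XS (f z)) ` strip)"
    and "\<And>z. z \<in> strip \<Longrightarrow> ((\<lambda>w. vnorm XS (f w - f z)) \<longlongrightarrow> 0) (at z within strip)"
    and "\<And>z. z \<in> interior strip \<Longrightarrow> \<exists>d. has_cderiv XS f d z"
    and "bdd_above (range (\<lambda>t::real. vnorm X0 (f (\<i> * t))))"
    and "bdd_above (range (\<lambda>t::real. vnorm X1 (f (1 + \<i> * t))))"
  using assms unfolding calderon_def Let_def by (simp_all)

section \<open>Derivatives of functions in the Calderon space\<close>

text \<open>The functionals \<open>avg K\<close> reduce derivatives with respect to the norm of the sum space to
  derivatives of scalar functions; the coordinate functionals among them show that such derivatives are
  unique.\<close>

lemma has_cderiv_avg:
  assumes f: "\<And>w. w \<in> strip \<Longrightarrow> f w \<in> vset ell2" and z: "z \<in> interior strip"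
    and d: "has_cderiv XS f d z"
  shows "((\<lambda>w. avg K (f w)) has_field_derivative avg K d) (at z)"
proof -
  have lim: "((\<lambda>w. vnorm XS (inverse (w - z) *\<^sub>C (f w - f z) - d)) \<longlongrightarrow> 0) (at z)" and d2: "d \<in> vset ell2"
    using d by (auto simp: has_cderiv_def)
  have "\<forall>\<^sub>F w in at z. w \<in> interior strip"
    using z by (intro eventually_at_topological[THEN iffD2]) (auto intro: open_interior)
  then have "\<forall>\<^sub>F w in at z. cmod ((avg K (f w) - avg K (f z)) / (w - z) - avg K d)
      \<le> vnorm XS (inverse (w - z) *\<^sub>C (f w - f z) - d)"
  proof eventually_elim
    case (elim w)
    then have "w \<in> strip" "z \<in> strip" using z interior_subset by blast+
    then have mem: "inverse (w - z) *\<^sub>C (f w - f z) - d \<in> vset ell2"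
      using f d2 by (intro ell2_diff ell2_scale)
    have "(avg K (f w) - avg K (f z)) / (w - z) - avg K d = avg K (inverse (w - z) *\<^sub>C (f w - f z) - d)"
      by (simp only: avg_diff avg_scale) (simp add: field_simps)
    then show ?case using functional_le_XS[OF mem avg_dual] by simp
  qed
  then have "((\<lambda>w. (avg K (f w) - avg K (f z)) / (w - z) - avg K d) \<longlongrightarrow> 0) (at z)"
    by (rule Lim_null_comparison) (rule lim)
  then show ?thesis by (simp add: has_field_derivative_iff LIM_zero_iff)
qed

lemma cderiv_eq:
  assumes f: "\<And>w. w \<in> strip \<Longrightarrow> f w \<in> vset ell2" and z: "z \<in> interior strip"
    and d: "has_cderiv XS f d z"
  shows "cderiv XS f z = d"
  unfolding cderiv_def
proof (rule the_equality, rule d)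
  fix d' assume d': "has_cderiv XS f d' z"
  show "d' = d"
  proof
    fix k
    have "avg {k} d' = avg {k} d"
      using DERIV_unique[OF has_cderiv_avg[OF f z d'] has_cderiv_avg[OF f z d]] by simp
    then show "d' k = d k" by (simp add: avg_def)
  qed
qed

lemma half_interior: "1/2 \<in> interior strip"
  by (simp add: interior_strip)

lemma cderiv_chi_lift:
  assumes "finite K"
  shows "cderiv XS (chi_lift b K) (1/2) = of_real b *\<^sub>C chi K"
proof (rule cderiv_eq[OF calderonD(1)[OF chi_lift_in_calderon[OF assms]] half_interior])
  show "has_cderiv XS (chi_lift b K) (of_real b *\<^sub>C chi K) (1/2)"
    using has_cderiv_chi_lift[OF assms half_interior, of b] by (simp add: expo_def)
qed

text \<open>The scalar function \<open>avg K \<circ> f\<close> is bounded by the norm of \<open>f\<close> on both sides of the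
  strip, and its derivative at \<open>1/2\<close> is \<open>avg K\<close> of the derivative of \<open>f\<close>.\<close>

lemma calderon_norm_lower:
  assumes f: "f \<in> vset (calderon X0 X1)"
  shows "cmod (avg K (cderiv XS f (1/2))) / 2 \<le> vnorm (calderon X0 X1) f"
proof -
  note D = calderonD[OF f]
  define h where "h = (\<lambda>z. avg K (f z))"
  define M where "M = vnorm (calderon X0 X1) f"
  have line: "\<i> * of_real t \<in> strip" "1 + \<i> * of_real t \<in> strip" for t by (auto simp: strip_def)
  have M: "M = max (SUP t::real. vnorm X0 (f (\<i> * t))) (SUP t::real. vnorm X1 (f (1 + \<i> * t)))"
    by (simp add: M_def calderon_def Let_def)
  have left: "cmod (h (\<i> * t)) \<le> M" for t :: real
    unfolding h_def M using functional_le_X0[OF D(1)[OF line(1)[of t]] avg_dual[of K]] cSUP_upper[OF UNIV_I D(5), of t] by simp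
  have right: "cmod (h (1 + \<i> * t)) \<le> M" for t :: real
    unfolding h_def M using functional_le_X1[OF D(1)[OF line(2)[of t]] avg_dual[of K]] cSUP_upper[OF UNIV_I D(6), of t] by simp
  have M0: "0 \<le> M" using left[of 0] norm_ge_zero order_trans by blast
  obtain B where B: "\<And>z. z \<in> strip \<Longrightarrow> vnorm XS (f z) \<le> B" using D(2) by (auto simp: bdd_above_def)
  have bdd: "cmod (h z) \<le> B" if "z \<in> strip" for z
    unfolding h_def using functional_le_XS[OF D(1)[OF that] avg_dual[of K]] B[OF that] by simp
  have cont: "continuous_on strip h"
    unfolding continuous_on_def
  proof
    fix z assume z: "z \<in> strip"
    have "\<forall>\<^sub>F w in at z within strip. cmod (h w - h z) \<le> vnorm XS (f w - f z)"
      unfolding eventually_at_filter h_def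
      by (intro always_eventually allI impI)
         (simp only: avg_diff[symmetric] functional_le_XS[OF ell2_diff[OF D(1) D(1)[OF z]] avg_dual])
    then have "((\<lambda>w. h w - h z) \<longlongrightarrow> 0) (at z within strip)"
      by (rule Lim_null_comparison) (rule D(3)[OF z])
    then show "(h \<longlongrightarrow> h z) (at z within strip)" by (simp add: LIM_zero_iff)
  qed
  have der: "(h has_field_derivative avg K (cderiv XS f z)) (at z)" if z: "z \<in> interior strip" for z
  proof -
    obtain d where d: "has_cderiv XS f d z" using D(4)[OF z] by blast
    have "cderiv XS f z = d" by (rule cderiv_eq[OF D(1) z d])
    then show ?thesis using has_cderiv_avg[OF D(1) z d] by (simp add: h_def)
  qed
  have hol: "h holomorphic_on interior strip"
    using der by (auto simp: holomorphic_on_open)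
  \<comment> \<open>The bound on the sides must be positive, hence the room \<open>e\<close>.\<close>
  have "cmod (avg K (cderiv XS f (1/2))) / 2 \<le> M + e" if "e > 0" for e
    using strip_derivative_bound[OF cont hol bdd, of "M + e"] left right M0 that
      DERIV_imp_deriv[OF der[OF half_interior]] by (simp add: add_increasing2)
  then show ?thesis unfolding M_def by (rule field_le_epsilon)
qed

section \<open>The matrix norms of the twisted sum\<close>

abbreviation "\<F> \<equiv> calderon_os (min_os ell2) (max_os ell2)"
abbreviation "jet \<equiv> \<lambda>f. (f (1/2), cderiv XS f (1/2))"

lemma oset_calderon [simp]: "oset \<F> = vset (calderon X0 X1)"
  by (simp add: calderon_os_def)

lemma do_ell2_simps:
  "oset do_ell2 = jet ` vset (calderon X0 X1)"
  "mnorm do_ell2 n x = Inf {mnorm \<F> n \<phi> | \<phi>. \<phi> \<in> vset (Mat n \<F>) \<and> (\<forall>i<n. \<forall>j<n. jet (\<phi> i j) = x i j)}"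
  by (simp_all add: do_ell2_def dX_def quotient_os_def)

lemma mnorm_calderon: "mnorm \<F> n \<phi> = max (SUP t::real. mnorm (min_os ell2) n (\<lambda>i j. \<phi> i j (\<i> * t)))
    (SUP t::real. mnorm (max_os ell2) n (\<lambda>i j. \<phi> i j (1 + \<i> * t)))"
  by (simp add: calderon_os_def calderon_def Mat_def Let_def)

text \<open>A supremum over a set without upper bound is an unspecified number, possibly negative. The one
  over the line \<open>Re z = 0\<close> is a true supremum of nonnegative numbers, because the boundedness of the
  entries bounds the Frobenius norm of every scalar image of the matrix. The infimum over liftings in the
  quotient is then a true one, too.\<close>

lemma mnorm_calderon_nonneg:
  assumes "\<phi> \<in> vset (Mat n \<F>)"
  shows "0 \<le> mnorm \<F> n \<phi>"
proof -
  have \<phi>: "\<phi> i j \<in> vset (calderon X0 X1)" if "i < n" "j < n" for i j using assms that by (simp add: Mat_def)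
  define B where "B i j = (SUP t::real. vnorm X0 (\<phi> i j (\<i> * t)))" for i j
  have line: "\<i> * of_real t \<in> strip" for t by (auto simp: strip_def)
  have B: "cmod (f (\<phi> i j (\<i> * of_real t))) \<le> B i j" if "i < n" "j < n" "f \<in> dual_ball ell2" for i j f t
    using functional_le_X0[OF calderonD(1)[OF \<phi>[OF that(1,2)] line] that(3), of t]
      cSUP_upper[OF UNIV_I calderonD(5)[OF \<phi>[OF that(1,2)]], of t] unfolding B_def by linarith
  have "mnorm (min_os ell2) n (\<lambda>i j. \<phi> i j (\<i> * of_real t)) \<le> sqrt (\<Sum>i<n. \<Sum>j<n. (B i j)\<^sup>2)" for t
    by (rule min_norm_upper, rule order_trans[OF scalar_matrix_norm_le_Frobenius])
       (intro real_sqrt_le_mono sum_mono power_mono B; simp)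
  then have bdd: "bdd_above (range (\<lambda>t::real. mnorm (min_os ell2) n (\<lambda>i j. \<phi> i j (\<i> * t))))"
    by (auto intro!: bdd_aboveI)
  have "0 \<le> scalar_matrix_norm n n (\<lambda>i j. 0)" by (rule scalar_matrix_norm_nonneg)
  also have "\<dots> \<le> mnorm (min_os ell2) n (\<lambda>i j. \<phi> i j (\<i> * of_real 0))"
    using min_norm_lower[of n "\<lambda>i j. \<phi> i j (\<i> * of_real 0)", OF calderonD(1)[OF \<phi> line] zero_dual_ball] .
  also have "\<dots> \<le> (SUP t::real. mnorm (min_os ell2) n (\<lambda>i j. \<phi> i j (\<i> * t)))"
    by (rule cSUP_upper[OF UNIV_I bdd])
  finally show ?thesis unfolding mnorm_calderon by simp
qed

lemma do_norm_bounds: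
  assumes "\<phi> \<in> vset (Mat n \<F>)" "\<And>i j. i < n \<Longrightarrow> j < n \<Longrightarrow> jet (\<phi> i j) = x i j"
  shows "mnorm do_ell2 n x \<le> mnorm \<F> n \<phi>" "0 \<le> mnorm do_ell2 n x"
proof -
  let ?S = "{mnorm \<F> n \<phi> | \<phi>. \<phi> \<in> vset (Mat n \<F>) \<and> (\<forall>i<n. \<forall>j<n. jet (\<phi> i j) = x i j)}"
  have mem: "mnorm \<F> n \<phi> \<in> ?S" using assms by blast
  have nonneg: "\<And>r. r \<in> ?S \<Longrightarrow> 0 \<le> r" using mnorm_calderon_nonneg by blast
  show "mnorm do_ell2 n x \<le> mnorm \<F> n \<phi>"
    unfolding do_ell2_simps by (rule cInf_lower[OF mem bdd_belowI[OF nonneg]])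
  show "0 \<le> mnorm do_ell2 n x"
    unfolding do_ell2_simps by (rule cInf_greatest[OF _ nonneg]) (use mem in blast)
qed

text \<open>A lifting of a \<open>1 \<times> 1\<close> matrix is a single function, with the same norm.\<close>

lemma do_norm_1_lower:
  assumes "x 0 0 \<in> oset do_ell2"
  shows "cmod (avg K (snd (x 0 0))) / 2 \<le> mnorm do_ell2 1 x"
  unfolding do_ell2_simps
proof (rule cInf_greatest)
  obtain f where f: "f \<in> vset (calderon X0 X1)" "jet f = x 0 0" using assms by (auto simp: do_ell2_simps)
  then have "(\<lambda>i j. if i = 0 \<and> j = 0 then f else 0) \<in> vset (Mat 1 \<F>)" by (auto simp: Mat_def)
  then show "{mnorm \<F> 1 \<phi> | \<phi>. \<phi> \<in> vset (Mat 1 \<F>) \<and> (\<forall>i<1. \<forall>j<1. jet (\<phi> i j) = x i j)} \<noteq> {}"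
    using f by fastforce
next
  fix r assume "r \<in> {mnorm \<F> 1 \<phi> | \<phi>. \<phi> \<in> vset (Mat 1 \<F>) \<and> (\<forall>i<1. \<forall>j<1. jet (\<phi> i j) = x i j)}"
  then obtain \<phi> where r: "r = mnorm \<F> 1 \<phi>" and \<phi>: "\<phi> \<in> vset (Mat 1 \<F>)" "jet (\<phi> 0 0) = x 0 0" by auto
  have f: "\<phi> 0 0 \<in> vset (calderon X0 X1)" and "\<phi> i j = (if i = 0 \<and> j = 0 then \<phi> 0 0 else 0)" for i j
    using \<phi> by (auto simp: Mat_def)
  then have "(\<lambda>i j. \<phi> i j z) = (\<lambda>i j. if i = 0 \<and> j = 0 then \<phi> 0 0 z else 0)" for z
    by (metis zero_fun_apply)
  then have "r = vnorm (calderon X0 X1) (\<phi> 0 0)"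
    unfolding r mnorm_calderon by (simp add: calderon_def Let_def base_def)
  then show "cmod (avg K (snd (x 0 0))) / 2 \<le> r"
    using calderon_norm_lower[OF f, of K] \<phi>(2) by (auto simp flip: \<phi>(2))
qed

section \<open>Rows and columns of basis vectors\<close>

text \<open>Rows and columns share one definition, with a flag for the shape, because every bound that follows
  is the same for both.\<close>

definition line_matrix :: "bool \<Rightarrow> nat \<Rightarrow> (nat \<Rightarrow> 'v::zero) \<Rightarrow> nat \<Rightarrow> nat \<Rightarrow> 'v" where
  "line_matrix across n v i j =
     (if across then if i = 0 \<and> j < n then v j else 0 else if j = 0 \<and> i < n then v i else 0)"

lemma sum_line_matrix:
  fixes g :: "'v::zero \<Rightarrow> real"
  assumes "g 0 = 0"
  shows "(\<Sum>i<n. \<Sum>j<n. g (line_matrix across n v i j)) = (\<Sum>k<n. g (v k))"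
proof -
  have *: "(\<Sum>i<n. \<Sum>j<n. g (line_matrix True n v i j)) = (\<Sum>k<n. g (v k))" for v
  proof -
    have "(\<Sum>i<n. \<Sum>j<n. g (line_matrix True n v i j)) = (\<Sum>i<n. if i = 0 then \<Sum>k<n. g (v k) else 0)"
      using assms by (intro sum.cong) (auto simp: line_matrix_def)
    then show ?thesis by (cases n) simp_all
  qed
  show ?thesis
  proof (cases across)
    case False
    have "(\<Sum>i<n. \<Sum>j<n. g (line_matrix across n v i j)) = (\<Sum>j<n. \<Sum>i<n. g (line_matrix True n v j i))"
      by (subst sum.swap) (simp add: line_matrix_def False)
    then show ?thesis using * by simp
  qed (use * in simp)
qed

lemma min_norm_line: "mnorm (min_os ell2) n (line_matrix across n (\<lambda>k. c *\<^sub>C chi {k})) \<le> cmod c"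
proof (rule min_norm_upper, rule order_trans[OF scalar_matrix_norm_le_Frobenius])
  fix f assume f: "f \<in> dual_ball ell2"
  have "(\<Sum>i<n. \<Sum>j<n. (cmod (f (line_matrix across n (\<lambda>k. c *\<^sub>C chi {k}) i j)))\<^sup>2)
    = (\<Sum>k<n. (cmod (f (c *\<^sub>C chi {k})))\<^sup>2)"
    by (rule sum_line_matrix[where g = "\<lambda>v. (cmod (f v))\<^sup>2"]) (simp add: dual_ball_0[OF f])
  then show "sqrt (\<Sum>i<n. \<Sum>j<n. (cmod (f (line_matrix across n (\<lambda>k. c *\<^sub>C chi {k}) i j)))\<^sup>2) \<le> cmod c"
    using dual_ball_Bessel[OF f, of c n] by (simp add: real_le_lsqrt)
qed

text \<open>The diagonal matrix with entries \<open>e\<^sub>k\<close> is multiplied by the identity on one side and by a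
  row or column of \<open>n\<close> constants on the other.\<close>

lemma max_norm_line: "mnorm (max_os ell2) n (line_matrix across n (\<lambda>k. c *\<^sub>C chi {k})) \<le> cmod c * sqrt n"
proof -
  have e: "chi {k} \<in> vset ell2" "vnorm ell2 (chi {k}) \<le> 1" for k
    using chi_ell2[of "{k}" 1] norm_chi[of "{k}" 1] by (simp_all add: scaleC_one)
  have "(\<Sum>i<n. \<Sum>j<n. (cmod (line_matrix across n (\<lambda>_. c) i j))\<^sup>2) = (\<Sum>k<n. (cmod c)\<^sup>2)"
    by (rule sum_line_matrix[where g = "\<lambda>v. (cmod v)\<^sup>2"]) simp
  then have A: "scalar_matrix_norm n n (line_matrix across n (\<lambda>_. c)) \<le> cmod c * sqrt n"
    using scalar_matrix_norm_le_Frobenius[of n n "line_matrix across n (\<lambda>_. c)"]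
    by (simp add: real_sqrt_mult mult.commute)
  show ?thesis
  proof (cases across)
    case True
    have "mnorm (max_os ell2) n (line_matrix across n (\<lambda>k. c *\<^sub>C chi {k})) \<le> cmod c * sqrt n * 1 * 1"
    proof (rule max_norm_upper[where d = "\<lambda>k. chi {k}", OF e(1) _ A e(2) _ scalar_matrix_norm_id])
      fix i j assume "i < n" "j < n"
      then show "line_matrix across n (\<lambda>k. c *\<^sub>C chi {k}) i j
        = (\<Sum>k<n. (line_matrix across n (\<lambda>_. c) i k * (if k = j then 1 else 0)) *\<^sub>C chi {k})"
        by (simp add: line_matrix_def True if_distrib[of "\<lambda>a. _ * a"] if_distrib[of "\<lambda>a. a *\<^sub>C _"] cong: if_cong)
    qed simp
    then show ?thesis by simp
  next
    case False
    have "mnorm (max_os ell2) n (line_matrix across n (\<lambda>k. c *\<^sub>C chi {k})) \<le> 1 * 1 * (cmod c * sqrt n)"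
    proof (rule max_norm_upper[where d = "\<lambda>k. chi {k}", OF e(1) _ scalar_matrix_norm_id e(2) _ A])
      fix i j assume "i < n" "j < n"
      then show "line_matrix across n (\<lambda>k. c *\<^sub>C chi {k}) i j
        = (\<Sum>k<n. ((if i = k then 1 else 0) * line_matrix across n (\<lambda>_. c) k j) *\<^sub>C chi {k})"
        by (simp add: line_matrix_def False if_distrib[of "\<lambda>a. a * _"] if_distrib[of "\<lambda>a. a *\<^sub>C _"] cong: if_cong)
    qed simp
    then show ?thesis by simp
  qed
qed

text \<open>The jet of \<open>chi_lift b K\<close> at \<open>1/2\<close>: the factor \<open>expo b\<close> leaves the value there
  unchanged and makes the derivative \<open>b\<close> times the value.\<close>

definition chi_pair :: "real \<Rightarrow> nat set \<Rightarrow> (nat \<Rightarrow> complex) \<times> (nat \<Rightarrow> complex)" where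
  "chi_pair b K = (chi K, of_real b *\<^sub>C chi K)"

lemma jet_chi_lift:
  assumes "finite K"
  shows "jet (chi_lift b K) = chi_pair b K"
proof -
  have "chi_lift b K (1/2) = chi K" by (simp add: chi_lift_def expo_def scaleC_one strip_def)
  then show ?thesis by (simp add: chi_pair_def cderiv_chi_lift assms)
qed

lemma chi_lift_empty: "chi_lift b {} = 0"
  by (simp add: chi_lift_def fun_eq_iff)

lemma zero_in_calderon: "0 \<in> vset (calderon X0 X1)"
  using chi_lift_in_calderon[of "{}" 0] by (simp add: chi_lift_empty)

lemma cderiv_zero: "cderiv XS 0 (1/2) = 0"
  using cderiv_chi_lift[of "{}" 0] by (simp add: chi_lift_empty)

lemma line_chi_lift:
  shows "line_matrix across n (\<lambda>k. chi_lift b {k}) \<in> vset (Mat n \<F>)"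
    and "jet (line_matrix across n (\<lambda>k. chi_lift b {k}) i j) = line_matrix across n (\<lambda>k. chi_pair b {k}) i j"
proof -
  show "line_matrix across n (\<lambda>k. chi_lift b {k}) \<in> vset (Mat n \<F>)"
    using chi_lift_in_calderon zero_in_calderon by (auto simp: Mat_def line_matrix_def)
  show "jet (line_matrix across n (\<lambda>k. chi_lift b {k}) i j) = line_matrix across n (\<lambda>k. chi_pair b {k}) i j"
    using jet_chi_lift[of "{_}" b] by (simp add: line_matrix_def cderiv_zero zero_prod_def)
qed

lemma do_line_mem: "line_matrix across n (\<lambda>k. chi_pair b {k}) \<in> vset (Mat n do_ell2)"
  using line_chi_lift(1)[of across n b]
  by (auto simp: Mat_def do_ell2_simps line_chi_lift(2)[symmetric]) (auto simp: line_matrix_def cderiv_zero zero_prod_def)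

text \<open>The lifting by \<open>chi_lift b {k}\<close> has the scalar factor \<open>exp (- b / 2)\<close> on the \<open>min\<close> side
  and \<open>exp (b / 2)\<close> on the \<open>max\<close> side.\<close>

lemma do_norm_line:
  "mnorm do_ell2 n (line_matrix across n (\<lambda>k. chi_pair b {k}))
     \<le> max (exp (- b / 2)) (exp (b / 2) * sqrt n)"
  "0 \<le> mnorm do_ell2 n (line_matrix across n (\<lambda>k. chi_pair b {k}))"
proof -
  note * = do_norm_bounds[OF line_chi_lift(1)[of across n b] line_chi_lift(2)]
  show "0 \<le> mnorm do_ell2 n (line_matrix across n (\<lambda>k. chi_pair b {k}))" by (rule *)
  have ev: "(\<lambda>i j. line_matrix across n (\<lambda>k. chi_lift b {k}) i j z) = line_matrix across n (\<lambda>k. expo b z *\<^sub>C chi {k})"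
    if "z \<in> strip" for z using that by (simp add: fun_eq_iff line_matrix_def chi_lift_def)
  have line: "\<i> * of_real t \<in> strip" "1 + \<i> * of_real t \<in> strip" for t by (auto simp: strip_def)
  have "mnorm \<F> n (line_matrix across n (\<lambda>k. chi_lift b {k})) \<le> max (exp (- b / 2)) (exp (b / 2) * sqrt n)"
    unfolding mnorm_calderon ev[OF line(1)] ev[OF line(2)]
    by (intro max.mono cSUP_least UNIV_not_empty order_trans[OF min_norm_line] order_trans[OF max_norm_line])
       (simp_all add: norm_expo)
  with *(1) show "mnorm do_ell2 n (line_matrix across n (\<lambda>k. chi_pair b {k}))
     \<le> max (exp (- b / 2)) (exp (b / 2) * sqrt n)" by simp
qed

section \<open>The product is not completely bounded\<close>

lemma chi_pair_mem: "finite K \<Longrightarrow> chi_pair b K \<in> oset do_ell2"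
  unfolding do_ell2_simps using chi_lift_in_calderon jet_chi_lift by (metis (no_types, lifting) image_eqI)

text \<open>The derivation rule doubles the slope \<open>b\<close>.\<close>

lemma chi_pair_mult: "do_mult (chi_pair b {k}) (chi_pair b {k}) = chi_pair (2 * b) {k}"
  by (auto simp: chi_pair_def fun_eq_iff indicator_def)

lemma chi_pair_Suc: "chi_pair b {..<Suc m} = chi_pair b {..<m} + chi_pair b {m}"
  by (auto simp: chi_pair_def fun_eq_iff indicator_def)

theorem theorem6p2:
  shows "\<not> operator_algebra TYPE('h::complex_hilbert) do_ell2 do_mult"
proof
  assume "operator_algebra TYPE('h) do_ell2 do_mult"
  then obtain \<pi> :: "(nat \<Rightarrow> complex) \<times> (nat \<Rightarrow> complex) \<Rightarrow> 'h \<Rightarrow> 'h"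
    where "algebra_representation do_ell2 do_mult \<pi>"
    unfolding operator_algebra_def by blast
  then obtain c C where ops: "\<And>x. x \<in> oset do_ell2 \<Longrightarrow> \<pi> x \<in> bounded_ops"
    and add: "\<And>x y. x \<in> oset do_ell2 \<Longrightarrow> y \<in> oset do_ell2 \<Longrightarrow> \<pi> (x + y) = (\<lambda>\<xi>. \<pi> x \<xi> + \<pi> y \<xi>)"
    and mult: "\<And>x y. x \<in> oset do_ell2 \<Longrightarrow> y \<in> oset do_ell2 \<Longrightarrow> \<pi> (do_mult x y) = \<pi> x \<circ> \<pi> y"
    and c: "c > 0"
    and lower: "\<And>n x. x \<in> vset (Mat n do_ell2) \<Longrightarrow> c * mnorm do_ell2 n x \<le> op_matrix_norm n n (\<lambda>i j. \<pi> (x i j))"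
    and upper: "\<And>n x. x \<in> vset (Mat n do_ell2) \<Longrightarrow> op_matrix_norm n n (\<lambda>i j. \<pi> (x i j)) \<le> C * mnorm do_ell2 n x"
    unfolding algebra_representation_def by blast
  have lin: "bounded_linear (\<pi> x)" if "x \<in> oset do_ell2" for x
    using ops[OF that] by (simp add: bounded_ops_def)
  have zero_eq: "chi_pair b {} = 0" for b by (simp add: chi_pair_def fun_eq_iff zero_prod_def)
  have zero_mem: "0 \<in> oset do_ell2" using chi_pair_mem[of "{}" 0] by (simp add: zero_eq)
  have \<pi>0: "\<pi> 0 = (\<lambda>_. 0)"
    using add[OF zero_mem zero_mem] by (simp add: fun_eq_iff)
  have key: "c * (ln n / 2) \<le> C\<^sup>2" if n: "n \<ge> 1" for n :: nat
  proof -
    \<comment> \<open>The slope that makes \<open>exp (- b / 2)\<close> and \<open>exp (b / 2) * sqrt n\<close> both equal to the fourth root of \<open>n\<close>.\<close>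
    define b where "b = - ln n / 2"
    define x where "x h = line_matrix h n (\<lambda>k. chi_pair b {k})" for h
    define G where "G = \<bar>C\<bar> * exp (ln n / 4)"
    have sqrt_n: "sqrt n = exp (ln n / 2)"
      using n by (simp add: ln_sqrt[symmetric])
    have x_mem: "x h \<in> vset (Mat n do_ell2)" for h
      unfolding x_def by (rule do_line_mem)
    have G: "op_matrix_norm n n (\<lambda>i j. \<pi> (x h i j)) \<le> G" for h
    proof -
      have "max (exp (- b / 2)) (exp (b / 2) * sqrt n) = exp (ln n / 4)"
        by (simp add: b_def sqrt_n mult_exp_exp)
      then have "mnorm do_ell2 n (x h) \<le> exp (ln n / 4)" "0 \<le> mnorm do_ell2 n (x h)"
        using do_norm_line[of n h b] unfolding x_def by simp_all
      then have "C * mnorm do_ell2 n (x h) \<le> \<bar>C\<bar> * exp (ln n / 4)"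
        by (intro mult_mono) auto
      then show ?thesis using upper[OF x_mem[of h]] unfolding G_def by linarith
    qed
    have x_lin: "bounded_linear (\<pi> (x h i j))" if "i < n" "j < n" for h i j
      using x_mem[of h] that by (intro lin) (simp add: Mat_def)
    have G0: "0 \<le> G" by (simp add: G_def)
    have op: "L2_set (\<lambda>i. norm (\<Sum>j<n. \<pi> (x h i j) (\<eta> j))) {..<n} \<le> G * L2_set (\<lambda>j. norm (\<eta> j)) {..<n}" for h \<eta>
      using op_matrix_norm_apply[of n n "\<lambda>i j. \<pi> (x h i j)" \<eta>, OF x_lin]
        mult_right_mono[OF G L2_set_nonneg[of "\<lambda>j. norm (\<eta> j)" "{..<n}"], of h] by (rule order_trans)
    define p where "p = chi_pair (2 * b) {..<n}"
    have p_mem: "p \<in> oset do_ell2" unfolding p_def by (rule chi_pair_mem) simp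
    have p_sum: "\<pi> p \<xi> = (\<Sum>k<n. \<pi> (chi_pair b {k}) (\<pi> (chi_pair b {k}) \<xi>))" for \<xi>
    proof -
      have "\<pi> (chi_pair (2 * b) {..<m}) \<xi> = (\<Sum>k<m. \<pi> (chi_pair b {k}) (\<pi> (chi_pair b {k}) \<xi>))" for m
      proof (induction m)
        case 0
        then show ?case by (simp add: zero_eq \<pi>0)
      next
        case (Suc m)
        have "\<pi> (chi_pair (2 * b) {m}) = \<pi> (chi_pair b {m}) \<circ> \<pi> (chi_pair b {m})"
          unfolding chi_pair_mult[symmetric] by (intro mult chi_pair_mem) simp_all
        moreover have "\<pi> (chi_pair (2 * b) {..<Suc m}) = (\<lambda>\<xi>. \<pi> (chi_pair (2 * b) {..<m}) \<xi> + \<pi> (chi_pair (2 * b) {m}) \<xi>)"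
          unfolding chi_pair_Suc by (intro add chi_pair_mem) simp_all
        ultimately show ?case using Suc by simp
      qed
      then show ?thesis by (simp add: p_def)
    qed
    \<comment> \<open>The operator of \<open>p\<close> is the row of the \<open>\<pi> (chi_pair b {k})\<close> applied to their column.\<close>
    have p_norm: "norm (\<pi> p \<xi>) \<le> G * (G * norm \<xi>)" for \<xi>
    proof -
      define \<eta> where "\<eta> k = \<pi> (chi_pair b {k}) \<xi>" for k
      have col: "(\<Sum>j<n. \<pi> (x False i j) (if j = 0 then \<xi> else 0)) = \<eta> i" if i: "i < n" for i
      proof -
        have "(\<Sum>j<n. \<pi> (x False i j) (if j = 0 then \<xi> else 0)) = (\<Sum>j<n. if j = 0 then \<eta> i else 0)"
          using i by (intro sum.cong) (auto simp: x_def line_matrix_def \<eta>_def \<pi>0)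
        then show ?thesis using n by simp
      qed
      have "L2_set (\<lambda>j. norm (if j = 0 then \<xi> else 0)) {..<n} = norm \<xi>"
      proof -
        have "(\<Sum>j<n. (norm (if j = 0 then \<xi> else 0))\<^sup>2) = (\<Sum>j<n. if j = 0 then (norm \<xi>)\<^sup>2 else 0)"
          by (intro sum.cong) auto
        then show ?thesis using n by (simp add: L2_set_def)
      qed
      moreover have "L2_set (\<lambda>i. norm (\<Sum>j<n. \<pi> (x False i j) (if j = 0 then \<xi> else 0))) {..<n}
        = L2_set (\<lambda>k. norm (\<eta> k)) {..<n}"
        by (intro L2_set_cong) (simp_all add: col)
      ultimately have 1: "L2_set (\<lambda>k. norm (\<eta> k)) {..<n} \<le> G * norm \<xi>"
        using op[of False "\<lambda>j. if j = 0 then \<xi> else 0"] by simp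
      have "\<pi> p \<xi> = (\<Sum>j<n. \<pi> (x True 0 j) (\<eta> j))"
        unfolding p_sum by (intro sum.cong) (auto simp: x_def line_matrix_def \<eta>_def)
      then have "norm (\<pi> p \<xi>) \<le> L2_set (\<lambda>i. norm (\<Sum>j<n. \<pi> (x True i j) (\<eta> j))) {..<n}"
        using member_le_L2_set[of "{..<n}" 0 "\<lambda>i. norm (\<Sum>j<n. \<pi> (x True i j) (\<eta> j))"] n by simp
      also have "\<dots> \<le> G * L2_set (\<lambda>k. norm (\<eta> k)) {..<n}" by (rule op)
      also have "\<dots> \<le> G * (G * norm \<xi>)" by (intro mult_left_mono 1 G0)
      finally show ?thesis .
    qed
    define P where "P = (\<lambda>(i::nat) (j::nat). if i = 0 \<and> j = 0 then p else 0)"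
    have P_mem: "P \<in> vset (Mat 1 do_ell2)" using p_mem by (auto simp: P_def Mat_def)
    have "op_matrix_norm 1 1 (\<lambda>i j. \<pi> (P i j)) \<le> G * G"
    proof (rule op_matrix_norm_least)
      fix \<xi> :: "nat \<Rightarrow> 'h" assume "(\<Sum>j<1. (norm (\<xi> j))\<^sup>2) \<le> 1"
      then have "norm (\<xi> 0) \<le> 1" using abs_square_le_1[of "norm (\<xi> 0)"] by simp
      then have "G * (G * norm (\<xi> 0)) \<le> G * (G * 1)" by (intro mult_left_mono G0)
      then show "sqrt (\<Sum>i<1. (norm (\<Sum>j<1. \<pi> (P i j) (\<xi> j)))\<^sup>2) \<le> G * G"
        using p_norm[of "\<xi> 0"] by (simp add: P_def)
    qed
    moreover have "ln n / 2 * sqrt n \<le> mnorm do_ell2 1 P"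
    proof -
      have "avg {..<n} (snd (P 0 0)) = of_real (2 * b) * of_real (sqrt n)"
        using avg_chi[of "{..<n}"] by (simp only: P_def p_def chi_pair_def avg_scale) (simp add: avg_scale)
      then have "cmod (avg {..<n} (snd (P 0 0))) = ln n * sqrt n"
        using n by (simp add: norm_mult b_def)
      then show ?thesis using do_norm_1_lower[of P "{..<n}"] p_mem by (simp add: P_def)
    qed
    ultimately have "c * (ln n / 2 * sqrt n) \<le> G * G"
      using lower[OF P_mem] mult_left_mono[of "ln n / 2 * sqrt n" "mnorm do_ell2 1 P" c] c by linarith
    also have "G * G = (\<bar>C\<bar> * \<bar>C\<bar>) * (exp (ln n / 4) * exp (ln n / 4))"
      by (simp only: G_def mult_ac)
    also have "\<dots> = C\<^sup>2 * sqrt n"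
      by (simp add: sqrt_n mult_exp_exp power2_eq_square)
    finally have "(c * (ln n / 2)) * sqrt n \<le> C\<^sup>2 * sqrt n" by (simp only: mult.assoc)
    then show ?thesis using n by (simp add: mult_le_cancel_right)
  qed
  define n where "n = nat \<lceil>exp (2 * C\<^sup>2 / c + 1)\<rceil>"
  have big: "exp (2 * C\<^sup>2 / c + 1) \<le> real n" unfolding n_def by linarith
  then have "real n > 0" using exp_gt_zero less_le_trans by blast
  then have n1: "n \<ge> 1" by linarith
  then have "2 * C\<^sup>2 / c + 1 \<le> ln n" using big by (simp add: ln_ge_iff)
  then have "c * ((2 * C\<^sup>2 / c + 1) / 2) \<le> c * (ln n / 2)" using c by (intro mult_left_mono) auto
  moreover have "c * ((2 * C\<^sup>2 / c + 1) / 2) = C\<^sup>2 + c / 2" using c by (simp add: field_simps)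
  ultimately show False using key[OF n1] c by linarith
qed

end
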